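(* Let $(\mathbb T^2,g)$ be a two-dimensional Riemannian torus and $m\ge1$. The kernel of the elliptic operator $\delta pd:C^\infty(\mathrm{Ker}^mj)\to C^\infty(\mathrm{Ker}^mj)$ is the two-dimensional space of tensor fields $f\in C^\infty(\mathrm{Ker}^mj)$ whose coordinates with respect to a global isothermal coordinate system are $f_{1\dots1}=e^{2m\mu}c^1$, $f_{1\dots12}=e^{2m\mu}c^2$, where $c=(c^1,c^2)$ is a constant pseudovector of weight $m$. The range of this operator consists of the fields $f\in C^\infty(\mathrm{Ker}^mj)$ all of whose components with respect to a global isothermal coordinate system have zero mean value: $\int_{\mathbb T^2}f_{i_1\dots i_m}\,d\sigma=0$, where $d\sigma=e^{2\mu}dxdy$ is the area form.
   Context: On a Riemannian manifold: $d=\sigma\nabla$ (symmetrized covariant derivative) on symmetric tensor fields, $\delta$ the divergence $(\delta f)_{i_1\dots i_m}=g^{pq}\nabla_pf_{qi_1\dots i_m}$, $j$ the trace with the metric, $\mathrm{Ker}^mj$ the bundle of trace free symmetric rank $m$ tensors, $p$ the orthogonal projection onto $\mathrm{Ker}\,j$ (tensor fields may be complex-valued). Global isothermal coordinates: there is a lattice $\Gamma\subset\mathbb R^2=\mathbb C$ with $\mathbb T^2=\mathbb C/\Gamma$ and $g=e^{2\mu(x,y)}(dx^2+dy^2)=\lambda(z)|dz|^2$, $z=x+iy$, $\mu$ smooth and $\Gamma$-periodic; these coordinates are unique up to $z=az'+b$ ($a\in\mathbb C\setminus\{0\}$, $b\in\mathbb C$) once an orientation is fixed. A trace free rank $m$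 field in such coordinates is determined by $f_{1\dots1}$ and $f_{1\dots12}$ via $f_{1\dots1\,2\dots2}+f_{1\dots1\,2\dots2\,22}=0$ (number of 2's $k$ and $k+2$). A pseudovector of weight $m$ assigns to each global isothermal coordinate system a pair $(X^1,X^2)$ such that under $z=az'$: $X^1+iX^2=a^m(X'^1+iX'^2)$, $X^1-iX^2=\bar a^m(X'^1-iX'^2)$; it is constant if $X^1,X^2$ are constants. *)

theory Defs
  imports "HOL-Analysis.Analysis"
begin

text \<open>Everything is expressed in a fixed global isothermal coordinate system
  z = x + iy on C, the torus being C modulo the lattice spanned by w1, w2, with metric
  g = exp(2 mu) (dx^2 + dy^2).  Coordinate indices are 1 (for x) and 2 (for y).
  A (covariant) tensor field of rank r is a map F :: nat list => complex => complex,
  F is z being the component F_{i_1...i_r} at z; components with index lists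
  outside idx r are required to be 0.\<close>

definition idx :: "nat \<Rightarrow> nat list set" where
  "idx r = {is. length is = r \<and> set is \<subseteq> {1,2}}"

definition pder :: "nat \<Rightarrow> (complex \<Rightarrow> 'b::real_normed_vector) \<Rightarrow> complex \<Rightarrow> 'b" where
  "pder k f z = vector_derivative (\<lambda>t. f (z + of_real t * (if k = 1 then 1 else \<i>))) (at 0)"

fun iter_pder :: "nat list \<Rightarrow> (complex \<Rightarrow> 'b::real_normed_vector) \<Rightarrow> complex \<Rightarrow> 'b" where
  "iter_pder [] f = f"
| "iter_pder (k # ks) f = pder k (iter_pder ks f)"

definition tsmooth :: "(complex \<Rightarrow> 'b::real_normed_vector) \<Rightarrow> bool" where
  "tsmooth f \<longleftrightarrow> (\<forall>ks. set ks \<subseteq> {1,2} \<longrightarrow> (\<forall>z. iter_pder ks f differentiable (at z)))"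

definition lattice_periodic :: "complex \<Rightarrow> complex \<Rightarrow> (complex \<Rightarrow> 'b) \<Rightarrow> bool" where
  "lattice_periodic w1 w2 f \<longleftrightarrow> (\<forall>z. f (z + w1) = f z \<and> f (z + w2) = f z)"

definition fund_dom :: "complex \<Rightarrow> complex \<Rightarrow> complex set" where
  "fund_dom w1 w2 = {of_real s * w1 + of_real t * w2 | s t. 0 \<le> s \<and> s < 1 \<and> 0 \<le> t \<and> t < 1}"

definition gmet :: "(complex \<Rightarrow> real) \<Rightarrow> nat \<Rightarrow> nat \<Rightarrow> complex \<Rightarrow> real" where
  "gmet mu i j z = (if i = j then exp (2 * mu z) else 0)"

definition ginv :: "(complex \<Rightarrow> real) \<Rightarrow> nat \<Rightarrow> nat \<Rightarrow> complex \<Rightarrow> real" where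
  "ginv mu i j z = (if i = j then exp (- 2 * mu z) else 0)"

definition chr :: "(complex \<Rightarrow> real) \<Rightarrow> nat \<Rightarrow> nat \<Rightarrow> nat \<Rightarrow> complex \<Rightarrow> real" where
  "chr mu k i j z = (1/2) * (\<Sum>l\<in>{1,2}. ginv mu k l z *
      (pder i (gmet mu j l) z + pder j (gmet mu i l) z - pder l (gmet mu i j) z))"

definition symt :: "nat \<Rightarrow> (nat list \<Rightarrow> complex) set" where
  "symt r = {h. (\<forall>is. is \<notin> idx r \<longrightarrow> h is = 0) \<and>
                (\<forall>is\<in>idx r. \<forall>js. mset js = mset is \<longrightarrow> h js = h is)}"

definition trace_pt :: "(complex \<Rightarrow> real) \<Rightarrow> complex \<Rightarrow> (nat list \<Rightarrow> complex) \<Rightarrow> nat list \<Rightarrow> complex" where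
  "trace_pt mu z h is = (\<Sum>p\<in>{1,2}. \<Sum>q\<in>{1,2}. of_real (ginv mu p q z) * h (p # q # is))"

text \<open>Ker^r j at the point z (for r < 2 this is all of the symmetric tensors).\<close>
definition kerj_pt :: "(complex \<Rightarrow> real) \<Rightarrow> nat \<Rightarrow> complex \<Rightarrow> (nat list \<Rightarrow> complex) set" where
  "kerj_pt mu r z = {h \<in> symt r. \<forall>is\<in>idx (r - 2). trace_pt mu z h is = 0}"

definition tinner :: "(complex \<Rightarrow> real) \<Rightarrow> nat \<Rightarrow> complex \<Rightarrow> (nat list \<Rightarrow> complex) \<Rightarrow> (nat list \<Rightarrow> complex) \<Rightarrow> complex" where
  "tinner mu r z u v = (\<Sum>is\<in>idx r. \<Sum>js\<in>idx r.
      of_real (\<Prod>a<r. ginv mu (is ! a) (js ! a) z) * u is * cnj (v js))"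

definition proj_pt :: "(complex \<Rightarrow> real) \<Rightarrow> nat \<Rightarrow> complex \<Rightarrow> (nat list \<Rightarrow> complex) \<Rightarrow> (nat list \<Rightarrow> complex)" where
  "proj_pt mu r z h = (THE h'. h' \<in> kerj_pt mu r z \<and>
      (\<forall>v\<in>kerj_pt mu r z. tinner mu r z (\<lambda>is. h is - h' is) v = 0))"

definition proj_field :: "(complex \<Rightarrow> real) \<Rightarrow> nat \<Rightarrow> (nat list \<Rightarrow> complex \<Rightarrow> complex) \<Rightarrow> nat list \<Rightarrow> complex \<Rightarrow> complex" where
  "proj_field mu r F = (\<lambda>is z. proj_pt mu r z (\<lambda>js. F js z) is)"

definition cov :: "(complex \<Rightarrow> real) \<Rightarrow> (nat list \<Rightarrow> complex \<Rightarrow> complex) \<Rightarrow> nat list \<Rightarrow> nat \<Rightarrow> complex \<Rightarrow> complex" where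
  "cov mu F is k z = pder k (F is) z
     - (\<Sum>a<length is. \<Sum>p\<in>{1,2}. of_real (chr mu p k (is ! a) z) * F (is[a := p]) z)"

definition nabla :: "(complex \<Rightarrow> real) \<Rightarrow> nat \<Rightarrow> (nat list \<Rightarrow> complex \<Rightarrow> complex) \<Rightarrow> nat list \<Rightarrow> complex \<Rightarrow> complex" where
  "nabla mu r F js z = (if js \<in> idx (r + 1) then cov mu F (butlast js) (last js) z else 0)"

definition symz :: "nat \<Rightarrow> (nat list \<Rightarrow> complex) \<Rightarrow> nat list \<Rightarrow> complex" where
  "symz r h js = (if js \<in> idx r then
      (1 / of_nat (fact r)) * (\<Sum>\<pi>\<in>{\<pi>. \<pi> permutes {..<r}}. h (map (\<lambda>a. js ! (\<pi> a)) [0..<r]))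
    else 0)"

definition dsym :: "(complex \<Rightarrow> real) \<Rightarrow> nat \<Rightarrow> (nat list \<Rightarrow> complex \<Rightarrow> complex) \<Rightarrow> nat list \<Rightarrow> complex \<Rightarrow> complex" where
  "dsym mu r F = (\<lambda>js z. symz (r + 1) (\<lambda>is. nabla mu r F is z) js)"

definition tdiv :: "(complex \<Rightarrow> real) \<Rightarrow> nat \<Rightarrow> (nat list \<Rightarrow> complex \<Rightarrow> complex) \<Rightarrow> nat list \<Rightarrow> complex \<Rightarrow> complex" where
  "tdiv mu r F is z = (if is \<in> idx r then
      (\<Sum>p\<in>{1,2}. \<Sum>q\<in>{1,2}. of_real (ginv mu p q z) * cov mu F (q # is) p z) else 0)"

definition kerj_fields :: "(complex \<Rightarrow> real) \<Rightarrow> complex \<Rightarrow> complex \<Rightarrow> nat \<Rightarrow> (nat list \<Rightarrow> complex \<Rightarrow> complex) set" where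
  "kerj_fields mu w1 w2 r = {F. (\<forall>is. tsmooth (F is) \<and> lattice_periodic w1 w2 (F is)) \<and>
      (\<forall>z. (\<lambda>is. F is z) \<in> kerj_pt mu r z)}"

definition dpd :: "(complex \<Rightarrow> real) \<Rightarrow> nat \<Rightarrow> (nat list \<Rightarrow> complex \<Rightarrow> complex) \<Rightarrow> nat list \<Rightarrow> complex \<Rightarrow> complex" where
  "dpd mu m F = tdiv mu m (proj_field mu (m + 1) (dsym mu m F))"

end

theory Submission
  imports Defs
begin

text \<open>A trace free field of rank m is \<open>u dz\<^sup>m + v dw\<^sup>m\<close>, with w the conjugate of z.  The projection of its symmetrized covariant
  derivative keeps only \<open>dz\<^sup>m\<^sup>+\<^sup>1\<close> and \<open>dw\<^sup>m\<^sup>+\<^sup>1\<close>, and the divergence brings these back to \<open>dz\<^sup>m\<close> and \<open>dw\<^sup>m\<close>.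
  So the operator acts separately on u and v, and on u it is
  \<open>e\<^sup>-\<^sup>2\<^sup>\<mu> dbar (1/2 e\<^sup>2\<^sup>m\<^sup>\<mu> del (e\<^sup>-\<^sup>2\<^sup>m\<^sup>\<mu> u))\<close> with \<open>dbar = \<partial>\<^sub>x + \<i> \<partial>\<^sub>y\<close> and \<open>del = \<partial>\<^sub>x - \<i> \<partial>\<^sub>y\<close> (conjugately on v).
  Both factors have constant coefficients up to multiplication by positive functions: on the torus
  dbar and del kill only the constants and, by Fourier series, their range consists of the functions of zero
  mean.  The constant left free by the first equation is what makes the second one solvable.\<close>

section \<open>Smooth functions and their partial derivatives\<close>

text \<open>Two definitions resist direct computation: \<open>dsym\<close> averages over all
  permutations of the indices, and \<open>proj_pt\<close> is a definite description. Both dissolve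
  under pairing with the r-th power of dz and its conjugate. These two tensors are orthogonal and
  span the trace free tensors, so two pairings give the projection, and a pairing with a symmetric
  tensor cannot see a symmetrization. The coefficients u and v decouple because the connection of a
  conformal metric sends dz to a multiple of dz tensor dz. Fourier theory is carried only as far as
  \<open>dbar f = h\<close> requires: Stone-Weierstrass replaces completeness in L2, and the symbol
  of \<open>dbar\<close> is a multiple of a lattice vector, hence bounded below by the size of the
  frequency. The coordinates being fixed, a constant pseudovector is just a pair of complex
  constants. Its law of transformation is the one under which
  \<open>exp (2 * m * mu) * (c1 - i c2) dz^m\<close> does not depend on the isothermal coordinates:
  z = a z' multiplies \<open>exp (2 * mu)\<close> by the squared modulus of a.\<close>

definition dir :: "nat \<Rightarrow> complex" where
  "dir k = (if k = 1 then 1 else \<i>)"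

lemma pder_eq:
  assumes "(f has_derivative D) (at z)"
  shows "pder k f z = D (dir k)"
proof -
  have "((\<lambda>t::real. z + of_real t * dir k) has_derivative (\<lambda>t. of_real t * dir k)) (at 0)"
    by (auto intro!: derivative_eq_intros)
  then have "((\<lambda>t::real. f (z + of_real t * dir k)) has_derivative (\<lambda>t. D (of_real t * dir k))) (at 0)"
    by (rule has_derivative_compose[where g' = D]) (use assms in simp)
  moreover have "D (of_real t * dir k) = t *\<^sub>R D (dir k)" for t
    using linear_scale[OF has_derivative_linear[OF assms], of t "dir k"] by (simp add: scaleR_conv_of_real)
  ultimately have "((\<lambda>t::real. f (z + of_real t * dir k)) has_vector_derivative D (dir k)) (at 0)"
    by (simp add: has_vector_derivative_def)
  then show ?thesis
    unfolding pder_def dir_def[symmetric] by (rule vector_derivative_at)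
qed

lemma frechet: "f differentiable F \<Longrightarrow> (f has_derivative frechet_derivative f F) F"
  by (simp only: frechet_derivative_works)

lemma pder_frechet:
  "f differentiable (at z) \<Longrightarrow> pder k f z = frechet_derivative f (at z) (dir k)"
  by (intro pder_eq frechet)

lemma pder_add:
  assumes "f differentiable (at z)" "g differentiable (at z)"
  shows "pder k (\<lambda>z. f z + g z) z = pder k f z + pder k g z"
  unfolding pder_frechet[OF assms(1)] pder_frechet[OF assms(2)]
  by (rule pder_eq[OF has_derivative_add[OF assms[THEN frechet]]])

lemma pder_mult:
  fixes f g :: "complex \<Rightarrow> complex"
  assumes "f differentiable (at z)" "g differentiable (at z)"
  shows "pder k (\<lambda>z. f z * g z) z = f z * pder k g z + pder k f z * g z"
  unfolding pder_frechet[OF assms(1)] pder_frechet[OF assms(2)]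
  by (rule pder_eq[OF has_derivative_mult[OF assms[THEN frechet]]])

lemma pder_const [simp]: "pder k (\<lambda>z. c) z = 0"
  by (rule pder_eq[OF has_derivative_const])

lemma pder_cmult:
  fixes f :: "complex \<Rightarrow> complex"
  assumes "f differentiable (at z)"
  shows "pder k (\<lambda>z. c * f z) z = c * pder k f z"
  using pder_mult[of "\<lambda>_. c" z f k] assms by simp

lemma pder_bounded_linear:
  assumes "bounded_linear l" "f differentiable (at z)"
  shows "pder k (\<lambda>z. l (f z)) z = l (pder k f z)"
  unfolding pder_frechet[OF assms(2)]
  by (rule pder_eq[OF bounded_linear.has_derivative[OF assms(1) frechet[OF assms(2)]]])

lemma has_derivative_exp_comp:
  fixes f :: "complex \<Rightarrow> 'b::{banach,real_normed_field}"
  assumes "(f has_derivative D) (at z)"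
  shows "((\<lambda>z. exp (f z)) has_derivative (\<lambda>v. exp (f z) * D v)) (at z)"
  by (rule has_derivative_compose[OF assms])
    (use DERIV_exp[of "f z"] in \<open>simp add: has_field_derivative_def\<close>)

lemma pder_exp:
  fixes f :: "complex \<Rightarrow> 'b::{banach,real_normed_field}"
  assumes "f differentiable (at z)"
  shows "pder k (\<lambda>z. exp (f z)) z = exp (f z) * pder k f z"
  unfolding pder_frechet[OF assms]
  by (rule pder_eq[OF has_derivative_exp_comp[OF frechet[OF assms]]])

lemma iter_pder_snoc: "iter_pder (ks @ [k]) f = iter_pder ks (pder k f)"
  by (induction ks) auto

text \<open>\<open>pder\<close> treats every index other than 1 as 2, while \<open>tsmooth\<close>
  speaks only of 1 and 2; normalizing k lets \<open>tsmooth_pder\<close> hold for arbitrary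
  k.\<close>

lemma pder_index: "pder (if k = 1 then 1 else 2) f = pder k f"
  by (auto simp: pder_def)

lemma tsmooth_differentiable: "tsmooth f \<Longrightarrow> f differentiable (at z)"
  unfolding tsmooth_def by (elim allE[of _ "[]"]) simp

lemma tsmooth_pder:
  assumes "tsmooth f" shows "tsmooth (pder k f)"
  unfolding tsmooth_def
proof (intro allI impI)
  fix ks z assume "set ks \<subseteq> {1,2::nat}"
  moreover define k' where "k' = (if k = 1 then 1 else (2::nat))"
  ultimately have "set (ks @ [k']) \<subseteq> {1,2}" by auto
  with assms have "iter_pder (ks @ [k']) f differentiable (at z)"
    unfolding tsmooth_def by blast
  then show "iter_pder ks (pder k f) differentiable (at z)"
    by (simp only: iter_pder_snoc k'_def pder_index)
qed

text \<open>Removing the innermost derivative turns a claim about g into one about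
  \<open>pder k g\<close>, which is again in the class X; hence the reverse induction on the index
  list. No formula for higher derivatives is ever needed.\<close>

lemma tsmooth_coinduct:
  assumes "X f"
    and step: "\<And>g. X g \<Longrightarrow> (\<forall>z. g differentiable (at z)) \<and> (\<forall>k. X (pder k g))"
  shows "tsmooth f"
proof -
  have "X g \<Longrightarrow> \<forall>z. iter_pder ks g differentiable (at z)" for ks g
  proof (induction ks arbitrary: g rule: rev_induct)
    case Nil
    then show ?case using step by simp
  next
    case (snoc k ks)
    then show ?case using step[of g] by (simp add: iter_pder_snoc)
  qed
  with assms(1) show ?thesis by (auto simp: tsmooth_def)
qed

lemma continuous_on_tsmooth:
  assumes "tsmooth f" shows "continuous_on A f"
  using tsmooth_differentiable[OF assms] differentiable_imp_continuous_within continuous_at_imp_continuous_on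
  by blast

text \<open>Closing the smooth functions under sums, products and exponentials first makes the
  Leibniz and chain rules stay inside the class, which is what coinduction needs.\<close>

inductive smooth_alg :: "(complex \<Rightarrow> complex) \<Rightarrow> bool" where
  base: "tsmooth f \<Longrightarrow> smooth_alg f"
| add: "smooth_alg f \<Longrightarrow> smooth_alg g \<Longrightarrow> smooth_alg (\<lambda>z. f z + g z)"
| mult: "smooth_alg f \<Longrightarrow> smooth_alg g \<Longrightarrow> smooth_alg (\<lambda>z. f z * g z)"
| exp: "smooth_alg f \<Longrightarrow> smooth_alg (\<lambda>z. exp (f z))"

lemma smooth_alg_step:
  "smooth_alg g \<Longrightarrow> (\<forall>z. g differentiable (at z)) \<and> (\<forall>k. smooth_alg (pder k g))"
proof (induction rule: smooth_alg.induct)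
  case (base f)
  then show ?case by (simp add: tsmooth_differentiable smooth_alg.base tsmooth_pder)
next
  case (add f g)
  then have "pder k (\<lambda>z. f z + g z) = (\<lambda>z. pder k f z + pder k g z)" for k
    by (simp add: fun_eq_iff pder_add)
  moreover have "(\<lambda>z. f z + g z) differentiable (at z)" for z
    using add.IH by (blast intro: differentiable_add)
  ultimately show ?case using add by (simp add: smooth_alg.add)
next
  case (mult f g)
  then have "pder k (\<lambda>z. f z * g z) = (\<lambda>z. f z * pder k g z + pder k f z * g z)" for k
    by (simp add: fun_eq_iff pder_mult)
  moreover have "(\<lambda>z. f z * g z) differentiable (at z)" for z
    using mult.IH by (blast intro: differentiable_mult)
  ultimately show ?case using mult by (simp add: smooth_alg.add smooth_alg.mult)
next
  case (exp f)
  then have "pder k (\<lambda>z. exp (f z)) = (\<lambda>z. exp (f z) * pder k f z)" for k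
    by (simp add: fun_eq_iff pder_exp)
  moreover have "(\<lambda>z. exp (f z)) differentiable (at z)" for z
    using exp has_derivative_exp_comp[of f _ z] unfolding differentiable_def by blast
  ultimately show ?case using exp by (simp add: smooth_alg.mult smooth_alg.exp)
qed

lemma smooth_alg_tsmooth: "smooth_alg f \<Longrightarrow> tsmooth f"
  by (rule tsmooth_coinduct[of smooth_alg, OF _ smooth_alg_step])

lemma tsmooth_add [intro]:
  "tsmooth f \<Longrightarrow> tsmooth g \<Longrightarrow> tsmooth (\<lambda>z. f z + g z :: complex)"
  by (rule smooth_alg_tsmooth) (rule smooth_alg.add; rule smooth_alg.base)

lemma tsmooth_mult [intro]:
  "tsmooth f \<Longrightarrow> tsmooth g \<Longrightarrow> tsmooth (\<lambda>z. f z * g z :: complex)"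
  by (rule smooth_alg_tsmooth) (rule smooth_alg.mult; rule smooth_alg.base)

lemma tsmooth_exp [intro]: "tsmooth f \<Longrightarrow> tsmooth (\<lambda>z. exp (f z :: complex))"
  by (rule smooth_alg_tsmooth) (rule smooth_alg.exp; rule smooth_alg.base)

lemma tsmooth_const [intro, simp]: "tsmooth (\<lambda>z. c)"
proof (rule tsmooth_coinduct[of "\<lambda>f. \<exists>c. f = (\<lambda>z. c)"])
  have "pder k (\<lambda>z. c::'a) = (\<lambda>z. 0)" for k c
    by (simp add: fun_eq_iff)
  then show "(\<forall>z. g differentiable (at z)) \<and> (\<forall>k. \<exists>c. pder k g = (\<lambda>z. c))"
    if "\<exists>c. g = (\<lambda>z. c::'a)" for g :: "complex \<Rightarrow> 'a"
    using that by auto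
qed blast

lemma tsmooth_cmult [intro]: "tsmooth f \<Longrightarrow> tsmooth (\<lambda>z. c * f z :: complex)"
  by (intro tsmooth_mult tsmooth_const)

lemma tsmooth_diff [intro]:
  assumes "tsmooth f" "tsmooth g"
  shows "tsmooth (\<lambda>z. f z - g z :: complex)"
  using tsmooth_add[OF assms(1) tsmooth_cmult[OF assms(2), of "-1"]] by simp

lemma tsmooth_bounded_linear:
  assumes l: "bounded_linear l" and "tsmooth f"
  shows "tsmooth (\<lambda>z. l (f z))"
proof (rule tsmooth_coinduct[of "\<lambda>g. \<exists>f. tsmooth f \<and> g = (\<lambda>z. l (f z))"])
  fix g assume "\<exists>f. tsmooth f \<and> g = (\<lambda>z. l (f z))"
  then obtain f where f: "tsmooth f" "g = (\<lambda>z. l (f z))" by blast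
  then have "pder k g = (\<lambda>z. l (pder k f z))" for k
    by (simp add: f(2) fun_eq_iff pder_bounded_linear[OF l] tsmooth_differentiable[OF f(1)])
  moreover have "g differentiable (at z)" for z
    using bounded_linear.has_derivative[OF l, of f _ "at z"] tsmooth_differentiable[OF f(1), of z] f(2)
    unfolding differentiable_def by blast
  ultimately show "(\<forall>z. g differentiable (at z)) \<and> (\<forall>k. \<exists>f. tsmooth f \<and> pder k g = (\<lambda>z. l (f z)))"
    using f(1) tsmooth_pder by blast
qed (use assms in blast)

lemmas tsmooth_cnj [intro] = tsmooth_bounded_linear[OF bounded_linear_cnj]
lemmas tsmooth_of_real = tsmooth_bounded_linear[OF bounded_linear_of_real]

text \<open>Twice the Wirtinger derivative in the conjugate variable; \<open>del\<close> is twice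
  the one in z.\<close>

definition dbar :: "(complex \<Rightarrow> complex) \<Rightarrow> complex \<Rightarrow> complex" where
  "dbar f z = pder 1 f z + \<i> * pder 2 f z"

definition del :: "(complex \<Rightarrow> complex) \<Rightarrow> complex \<Rightarrow> complex" where
  "del f z = pder 1 f z - \<i> * pder 2 f z"

lemma pder_cnj:
  "f differentiable (at z) \<Longrightarrow> pder k (\<lambda>z. cnj (f z)) z = cnj (pder k f z)"
  by (rule pder_bounded_linear[OF bounded_linear_cnj])

lemma dbar_cnj: "tsmooth f \<Longrightarrow> dbar (\<lambda>z. cnj (f z)) = (\<lambda>z. cnj (del f z))"
  by (simp add: fun_eq_iff dbar_def del_def pder_cnj tsmooth_differentiable)

lemma del_cnj: "tsmooth f \<Longrightarrow> del (\<lambda>z. cnj (f z)) = (\<lambda>z. cnj (dbar f z))"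
  by (simp add: fun_eq_iff dbar_def del_def pder_cnj tsmooth_differentiable)

lemma tsmooth_dbar [intro]: "tsmooth f \<Longrightarrow> tsmooth (dbar f)"
  unfolding dbar_def[abs_def] by (intro tsmooth_add tsmooth_cmult tsmooth_pder)

lemma tsmooth_del [intro]: "tsmooth f \<Longrightarrow> tsmooth (del f)"
  unfolding del_def[abs_def] by (intro tsmooth_diff tsmooth_cmult tsmooth_pder)

lemma periodic_pder:
  "lattice_periodic w1 w2 f \<Longrightarrow> lattice_periodic w1 w2 (pder k f)"
  by (simp add: lattice_periodic_def pder_def add.commute[of _ w1] add.commute[of _ w2] add.assoc)

lemma periodic_dbar [intro]: "lattice_periodic w1 w2 f \<Longrightarrow> lattice_periodic w1 w2 (dbar f)"
  using periodic_pder[of w1 w2 f] by (simp add: lattice_periodic_def dbar_def)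

lemma periodic_del [intro]: "lattice_periodic w1 w2 f \<Longrightarrow> lattice_periodic w1 w2 (del f)"
  using periodic_pder[of w1 w2 f] by (simp add: lattice_periodic_def del_def)

section \<open>Integration over the torus\<close>

lemma set_integral_translate:
  fixes f :: "'a::euclidean_space \<Rightarrow> complex"
  assumes [measurable]: "f \<in> borel_measurable borel" "S \<in> sets borel"
  shows "(LINT z:S|lborel. f (z + v)) = (LINT z:{z. z - v \<in> S}|lborel. f z)"
proof -
  let ?g = "\<lambda>z. indicator {z. z - v \<in> S} z *\<^sub>R f z"
  have "(LINT z|distr lborel borel ((+) v). ?g z) = (LINT z|lborel. ?g (v + z))"
    by (rule integral_distr) measurable
  then have "(LINT z|lborel. ?g z) = (LINT z|lborel. ?g (v + z))"
    by (simp only: lborel_distr_plus)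
  then show ?thesis
    by (simp add: set_lebesgue_integral_def add.commute indicator_def)
qed

text \<open>Translating a half-open strip along its own direction pushes one end out; shifting that
  end back by a full period restores the strip.\<close>

lemma strip_translate:
  fixes f :: "complex \<Rightarrow> complex" and p :: "complex \<Rightarrow> real"
  assumes f: "continuous_on UNIV f" and per: "\<And>z. f (z + w) = f z"
    and E [measurable]: "E \<in> sets borel" and shiftE: "\<And>z a. z - of_real a * w \<in> E \<longleftrightarrow> z \<in> E"
    and p: "continuous_on UNIV p" and shiftp: "\<And>z a. p (z - of_real a * w) = p z - a"
    and D: "D = {z\<in>E. 0 \<le> p z \<and> p z < 1}"
    and int: "\<And>g::complex \<Rightarrow> complex. continuous_on UNIV g \<Longrightarrow> set_integrable lborel D g"
    and a: "0 \<le> a" "a < 1"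
  shows "(LINT z:D|lborel. f (z + of_real a * w)) = (LINT z:D|lborel. f z)"
proof -
  have [measurable]: "f \<in> borel_measurable borel" "p \<in> borel_measurable borel"
    using f p by (auto intro: borel_measurable_continuous_onI)
  define A where "A = {z\<in>E. 0 \<le> p z \<and> p z < 1 - a}"
  define B where "B = {z\<in>E. 1 - a \<le> p z \<and> p z < 1}"
  define A' where "A' = {z\<in>E. a \<le> p z \<and> p z < 1}"
  define B' where "B' = {z\<in>E. 0 \<le> p z \<and> p z < a}"
  have AB: "D = A \<union> B" "A \<inter> B = {}" "D = A' \<union> B'" "A' \<inter> B' = {}"
    using a by (auto simp: A_def B_def A'_def B'_def D)
  have [measurable]: "A \<in> sets borel" "B \<in> sets borel" "A' \<in> sets borel" "B' \<in> sets borel"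
    unfolding A_def B_def A'_def B'_def by measurable
  have cont: "continuous_on UNIV (\<lambda>z. f (z + c))" for c
    by (rule continuous_on_compose2[OF f]) (auto intro!: continuous_intros)
  have sub: "set_integrable lborel S g"
    if "continuous_on UNIV g" "S \<subseteq> D" "S \<in> sets borel" for S and g :: "complex \<Rightarrow> complex"
    using set_integrable_subset[OF int[OF that(1)], of S] that by simp
  have "(LINT z:D|lborel. f (z + of_real a * w)) =
      (LINT z:A|lborel. f (z + of_real a * w)) + (LINT z:B|lborel. f (z + of_real a * w))"
    unfolding AB(1) by (intro set_integral_Un AB sub cont) (auto simp: AB(1))
  also have "(LINT z:A|lborel. f (z + of_real a * w)) =
      (LINT z:{z. z - of_real a * w \<in> A}|lborel. f z)"
    by (rule set_integral_translate) auto
  also have "{z. z - of_real a * w \<in> A} = A'"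
    by (auto simp: A_def A'_def shiftE shiftp)
  \<comment> \<open>Periodicity replaces \<open>a\<close> by \<open>a - 1\<close>, and translation
    by the latter moves \<open>B\<close> onto the beginning of the strip.\<close>
  also have "(LINT z:B|lborel. f (z + of_real a * w)) = (LINT z:B|lborel. f (z + of_real (a - 1) * w))"
    using per[of "_ + of_real (a - 1) * w"] by (simp add: algebra_simps)
  also have "\<dots> = (LINT z:{z. z - of_real (a - 1) * w \<in> B}|lborel. f z)"
    by (rule set_integral_translate) auto
  also have "{z. z - of_real (a - 1) * w \<in> B} = B'"
    unfolding B_def B'_def mem_Collect_eq shiftE shiftp by auto
  also have "(LINT z:A'|lborel. f z) + (LINT z:B'|lborel. f z) = (LINT z:D|lborel. f z)"
    unfolding AB(3) by (intro set_integral_Un[symmetric] AB sub f) (auto simp: AB(3))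
  finally show ?thesis .
qed

lemma periodic_int_multiple:
  fixes f :: "complex \<Rightarrow> 'b"
  assumes per: "\<And>z. f (z + w) = f z"
  shows "f (z + of_int n * w) = f z"
proof (induction n arbitrary: z rule: int_induct[of _ 0])
  case (step1 i)
  then show ?case using per[of "z + of_int i * w"] by (simp add: algebra_simps)
next
  case (step2 i)
  then show ?case using per[of "z + of_int (i - 1) * w"] by (simp add: algebra_simps)
qed simp

section \<open>Lattice coordinates, the fundamental cell and invariance of the integral\<close>

locale torus =
  fixes w1 w2 :: complex
  assumes lattice: "Im (cnj w1 * w2) \<noteq> 0"
begin

abbreviation D :: "complex set" where "D \<equiv> fund_dom w1 w2"

text \<open>Cramer's rule: \<open>Im (cnj a * b)\<close> is the determinant of a and b, so
  \<open>lattice\<close> says that w1 and w2 are independent over the reals, and \<open>c1\<close>,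
  \<open>c2\<close> are the coordinates in this basis.\<close>

definition c1 :: "complex \<Rightarrow> real" where "c1 z = Im (cnj z * w2) / Im (cnj w1 * w2)"
definition c2 :: "complex \<Rightarrow> real" where "c2 z = Im (cnj w1 * z) / Im (cnj w1 * w2)"

lemma coords: "z = of_real (c1 z) * w1 + of_real (c2 z) * w2"
proof -
  let ?d = "Im (cnj w1 * w2)"
  have "?d * Re z = Im (cnj z * w2) * Re w1 + Im (cnj w1 * z) * Re w2"
    "?d * Im z = Im (cnj z * w2) * Im w1 + Im (cnj w1 * z) * Im w2"
    by (simp_all add: algebra_simps)
  then have "Re z = c1 z * Re w1 + c2 z * Re w2" "Im z = c1 z * Im w1 + c2 z * Im w2"
    using lattice by (simp_all only: c1_def c2_def times_divide_eq_left add_divide_distrib[symmetric])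
      (metis nonzero_mult_div_cancel_left)+
  then show ?thesis by (simp add: complex_eq_iff)
qed

lemma c1_add [simp]: "c1 (u + v) = c1 u + c1 v" and c2_add [simp]: "c2 (u + v) = c2 u + c2 v"
  by (simp_all add: c1_def c2_def add_divide_distrib[symmetric] distrib_left distrib_right
      del: times_complex.sel)

lemma c1_diff [simp]: "c1 (u - v) = c1 u - c1 v" and c2_diff [simp]: "c2 (u - v) = c2 u - c2 v"
  by (simp_all add: c1_def c2_def diff_divide_distrib[symmetric] left_diff_distrib right_diff_distrib
      del: times_complex.sel)

lemma c1_scale [simp]: "c1 (of_real a * v) = a * c1 v" and c2_scale [simp]: "c2 (of_real a * v) = a * c2 v"
  by (simp_all add: c1_def c2_def algebra_simps)

lemma c_basis [simp]: "c1 w1 = 1" "c2 w1 = 0" "c1 w2 = 0" "c2 w2 = 1"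
  using lattice by (simp_all add: c1_def c2_def)

lemma bounded_linear_c1: "bounded_linear c1"
proof -
  have "bounded_linear (\<lambda>z. Im (cnj z * w2) / Im (cnj w1 * w2))"
    by (intro bounded_linear_compose[OF bounded_linear_divide] bounded_linear_compose[OF bounded_linear_Im]
      bounded_linear_compose[OF bounded_linear_mult_left] bounded_linear_cnj)
  then show ?thesis by (simp only: c1_def[abs_def])
qed

lemma bounded_linear_c2: "bounded_linear c2"
proof -
  have "bounded_linear (\<lambda>z. Im (cnj w1 * z) / Im (cnj w1 * w2))"
    by (intro bounded_linear_compose[OF bounded_linear_divide] bounded_linear_compose[OF bounded_linear_Im]
      bounded_linear_mult_right)
  then show ?thesis by (simp only: c2_def[abs_def])
qed

lemma continuous_c [continuous_intros]: "continuous_on A c1" "continuous_on A c2"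
  using bounded_linear_c1 bounded_linear_c2 by (auto intro: linear_continuous_on)

lemma measurable_c [measurable]: "c1 \<in> borel_measurable borel" "c2 \<in> borel_measurable borel"
  by (auto intro: borel_measurable_continuous_onI continuous_c)

lemma D_eq: "D = {z. 0 \<le> c1 z \<and> c1 z < 1 \<and> 0 \<le> c2 z \<and> c2 z < 1}"
proof -
  have "z \<in> D" if "0 \<le> c1 z \<and> c1 z < 1 \<and> 0 \<le> c2 z \<and> c2 z < 1" for z
    unfolding fund_dom_def using that coords[of z] by blast
  moreover have "0 \<le> c1 z \<and> c1 z < 1 \<and> 0 \<le> c2 z \<and> c2 z < 1" if "z \<in> D" for z
    using that by (auto simp: fund_dom_def)
  ultimately show ?thesis by blast
qed

lemma D_borel [measurable]: "D \<in> sets borel"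
  unfolding D_eq by measurable

text \<open>The closed cell: \<open>D\<close> is half-open and not compact, so bounds and
  integrability are taken from \<open>K\<close>.\<close>

definition K :: "complex set" where
  "K = (\<lambda>(a,b). of_real a * w1 + of_real b * w2) ` ({0..1} \<times> {0..1})"

lemma compact_K: "compact K"
  unfolding K_def case_prod_unfold
  by (intro compact_continuous_image continuous_intros compact_Times) auto

lemma D_subset_K: "D \<subseteq> K"
  by (force simp: fund_dom_def K_def)

lemma integrable_D:
  fixes f :: "complex \<Rightarrow> 'b::{banach,second_countable_topology}"
  assumes "continuous_on UNIV f"
  shows "set_integrable lborel D f"
proof (rule set_integrable_subset)
  show "set_integrable lborel K f"
    unfolding set_integrable_def using compact_K assms
    by (intro borel_integrable_compact) (auto intro: continuous_on_subset)
qed (use D_subset_K D_borel in auto)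

abbreviation tint :: "(complex \<Rightarrow> complex) \<Rightarrow> complex" where
  "tint f \<equiv> LINT z:D|lborel. f z"

lemma integral_eq_tint: "continuous_on UNIV f \<Longrightarrow> integral D f = tint f"
  by (rule set_borel_integral_eq_integral(2)[symmetric]) (rule integrable_D)

definition tcont :: "(complex \<Rightarrow> complex) \<Rightarrow> bool" where
  "tcont f \<longleftrightarrow> continuous_on UNIV f \<and> lattice_periodic w1 w2 f"

lemma tcontD: "tcont f \<Longrightarrow> continuous_on UNIV f" "tcont f \<Longrightarrow> lattice_periodic w1 w2 f"
  by (auto simp: tcont_def)

lemma tcont_add: "tcont f \<Longrightarrow> tcont g \<Longrightarrow> tcont (\<lambda>z. f z + g z)"
  and tcont_diff: "tcont f \<Longrightarrow> tcont g \<Longrightarrow> tcont (\<lambda>z. f z - g z)"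
  and tcont_mult: "tcont f \<Longrightarrow> tcont g \<Longrightarrow> tcont (\<lambda>z. f z * g z)"
  and tcont_cnj: "tcont f \<Longrightarrow> tcont (\<lambda>z. cnj (f z))"
  and tcont_const: "tcont (\<lambda>z. c)"
  by (auto simp: tcont_def lattice_periodic_def intro!: continuous_intros)

lemma tcont_translate: "tcont f \<Longrightarrow> tcont (\<lambda>z. f (z + v))"
  unfolding tcont_def lattice_periodic_def
  by (auto intro!: continuous_on_compose2[of UNIV f] continuous_intros simp: add.assoc add.commute[of _ v])
     (simp_all add: add.assoc[symmetric])

lemma tint_add: "tcont f \<Longrightarrow> tcont g \<Longrightarrow> tint (\<lambda>z. f z + g z) = tint f + tint g"
  by (auto intro!: set_integral_add(2) integrable_D tcontD)

lemma tint_diff: "tcont f \<Longrightarrow> tcont g \<Longrightarrow> tint (\<lambda>z. f z - g z) = tint f - tint g"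
  by (auto intro!: set_integral_diff(2) integrable_D tcontD)

lemma periodic_lattice:
  assumes "lattice_periodic w1 w2 f"
  shows "f (z + of_int j * w1 + of_int k * w2) = f z"
  using assms periodic_int_multiple[of f w1 z j] periodic_int_multiple[of f w2 "z + of_int j * w1" k]
  by (simp add: lattice_periodic_def)

text \<open>Discarding the integer parts leaves shifts in [0,1) along each period, the range that
  \<open>strip_translate\<close> covers.\<close>

lemma periodic_frac:
  assumes "lattice_periodic w1 w2 f"
  shows "f (z + v) = f (z + of_real (frac (c1 v)) * w1 + of_real (frac (c2 v)) * w2)"
proof -
  have "z + v = (z + of_real (frac (c1 v)) * w1 + of_real (frac (c2 v)) * w2)
      + of_int \<lfloor>c1 v\<rfloor> * w1 + of_int \<lfloor>c2 v\<rfloor> * w2"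
    using coords[of v] by (simp add: frac_def algebra_simps)
  then show ?thesis using periodic_lattice[OF assms] by metis
qed

lemma tcont_bounded:
  assumes "tcont f"
  obtains B where "0 < B" "\<And>z. norm (f z) \<le> B"
proof -
  have "compact (f ` K)"
    using assms compact_K by (intro compact_continuous_image) (auto simp: tcont_def intro: continuous_on_subset)
  then obtain B where B: "0 < B" "\<And>y. y \<in> f ` K \<Longrightarrow> norm y \<le> B"
    using compact_imp_bounded bounded_pos by metis
  have "norm (f z) \<le> B" for z
  proof (rule B(2))
    have "f z = f (of_real (frac (c1 z)) * w1 + of_real (frac (c2 z)) * w2)"
      using periodic_frac[of f 0 z] assms by (simp add: tcont_def)
    moreover have "of_real (frac (c1 z)) * w1 + of_real (frac (c2 z)) * w2 \<in> K"
      unfolding K_def by (rule image_eqI[of _ _ "(frac (c1 z), frac (c2 z))"])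
        (auto simp: less_imp_le[OF frac_lt_1])
    ultimately show "f z \<in> f ` K" by blast
  qed
  with B(1) show ?thesis by (rule that)
qed

text \<open>Modulo the lattice a translation splits into a fractional shift along w1 and one along
  w2, each of which moves the cell inside its own strip.\<close>

lemma tint_translate:
  assumes f: "tcont f"
  shows "tint (\<lambda>z. f (z + v)) = tint f"
proof -
  have 1: "tint (\<lambda>z. g (z + of_real a * w1)) = tint g" if g: "tcont g" and a: "0 \<le> a" "a < 1" for g a
    by (rule strip_translate[where E = "{z. 0 \<le> c2 z \<and> c2 z < 1}" and p = c1])
       (use g a in \<open>auto simp: tcont_def lattice_periodic_def D_eq continuous_c integrable_D[unfolded D_eq]\<close>)
  have 2: "tint (\<lambda>z. g (z + of_real a * w2)) = tint g" if g: "tcont g" and a: "0 \<le> a" "a < 1" for g a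
    by (rule strip_translate[where E = "{z. 0 \<le> c1 z \<and> c1 z < 1}" and p = c2])
       (use g a in \<open>auto simp: tcont_def lattice_periodic_def D_eq continuous_c integrable_D[unfolded D_eq]\<close>)
  let ?a = "frac (c1 v)" and ?b = "frac (c2 v)"
  have "(\<lambda>z. f (z + v)) = (\<lambda>z. f (z + of_real ?a * w1 + of_real ?b * w2))"
    using periodic_frac[of f] f by (simp add: tcont_def)
  then have "tint (\<lambda>z. f (z + v)) = tint (\<lambda>z. f (z + of_real ?a * w1 + of_real ?b * w2))"
    by simp
  also have "\<dots> = tint (\<lambda>z. f (z + of_real ?b * w2))"
    using 1[OF tcont_translate[OF f, of "of_real ?b * w2"], of ?a] by (simp add: frac_lt_1)
  also have "\<dots> = tint f"
    by (rule 2[OF f]) (auto simp: frac_lt_1)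
  finally show ?thesis .
qed

text \<open>A positive value spreads to an open set of positive measure. Since z0 may lie outside
  the cell or on its boundary, it is first translated to the centre \<open>d\<close> of the
  cell.\<close>

lemma tint_nonneg_eq_0:
  fixes q :: "complex \<Rightarrow> real"
  assumes q: "tcont (\<lambda>z. of_real (q z))" and nonneg: "\<And>z. 0 \<le> q z"
    and zero: "tint (\<lambda>z. of_real (q z)) = 0"
  shows "q z0 = 0"
proof -
  define d where "d = of_real (1/2) * w1 + of_real (1/2) * w2"
  define r where "r = (\<lambda>z. q (z + (z0 - d)))"
  have tr: "tcont (\<lambda>z. of_real (r z))"
    using tcont_translate[OF q, of "z0 - d"] by (simp add: r_def)
  then have cr: "continuous_on UNIV r"
    using continuous_on_Re[OF tcontD(1)] by fastforce
  then have [measurable]: "r \<in> borel_measurable borel"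
    by (rule borel_measurable_continuous_onI)
  have "of_real (LINT z:D|lborel. r z) = tint (\<lambda>z. of_real (r z))"
    by (simp add: set_integral_complex_of_real)
  also have "\<dots> = 0"
    using tint_translate[OF q, of "z0 - d"] zero by (simp add: r_def)
  finally have "(LINT z|lborel. indicator D z *\<^sub>R r z) = 0"
    by (simp add: set_lebesgue_integral_def)
  moreover have "integrable lborel (\<lambda>z. indicator D z *\<^sub>R r z)"
    using integrable_D[OF cr] by (simp add: set_integrable_def)
  ultimately have "AE z in lborel. indicator D z *\<^sub>R r z = 0"
    by (subst (asm) integral_nonneg_eq_0_iff_AE) (auto simp: r_def nonneg)
  then have "{z. indicator D z *\<^sub>R r z \<noteq> 0} \<in> null_sets lborel"
    by (subst (asm) AE_iff_null) auto
  then have neg: "negligible {z. indicator D z *\<^sub>R r z \<noteq> 0}"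
    by (simp add: negligible_iff_null_sets null_sets_completionI)
  define U where "U = {z. 0 < c1 z} \<inter> {z. c1 z < 1} \<inter> {z. 0 < c2 z} \<inter> {z. c2 z < 1} \<inter> {z. 0 < r z}"
  have "open U"
    unfolding U_def by (intro open_Int open_Collect_less continuous_c cr continuous_intros)
  moreover have "U \<subseteq> {z. indicator D z *\<^sub>R r z \<noteq> 0}"
    by (auto simp: U_def D_eq)
  then have "negligible U"
    using neg negligible_subset by blast
  ultimately have "U = {}"
    using open_not_negligible by blast
  then have "d \<notin> U" by simp
  moreover have "r d = q z0" by (simp add: r_def)
  moreover have "c1 d = 1/2" "c2 d = 1/2"
    unfolding d_def by (simp_all only: c1_add c2_add c1_scale c2_scale c_basis)
  ultimately show ?thesis
    using nonneg[of z0] by (auto simp: U_def)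
qed

lemma norm_tint_le:
  assumes f: "tcont f" and B: "\<And>z. norm (f z) \<le> B"
  shows "norm (tint f) \<le> B * measure lborel D"
proof -
  have "norm (tint f) \<le> (LINT z:D|lborel. norm (f z))"
    using f by (intro set_integral_norm_bound integrable_D) (auto simp: tcont_def)
  also have "\<dots> \<le> (LINT z:D|lborel. B)"
    using f B by (intro set_integral_mono integrable_D) (auto simp: tcont_def intro!: continuous_intros)
  also have "\<dots> = B * measure lborel D"
    by (simp add: set_lebesgue_integral_def mult.commute)
  finally show ?thesis .
qed

text \<open>No boundary terms are computed: difference quotients have integral 0 by translation
  invariance, the mean value inequality bounds them by a bound of the derivative, and dominated
  convergence passes to the limit.\<close>

lemma tint_pder:
  assumes f: "tsmooth f" and per: "lattice_periodic w1 w2 f"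
  shows "tint (pder k f) = 0"
proof -
  have tf: "tcont f" and tp: "tcont (pder k f)" for k
    using f per by (auto simp: tcont_def continuous_on_tsmooth tsmooth_pder periodic_pder)
  obtain B where B: "0 < B" "\<And>z. norm (pder k f z) \<le> B"
    using tcont_bounded[OF tp] by metis
  define h where "h = (\<lambda>n::nat. 1 / real (Suc n))"
  have h: "h n > 0" for n by (simp add: h_def)
  define q where "q = (\<lambda>n z. (f (z + of_real (h n) * dir k) - f z) / of_real (h n))"
  have vd: "((\<lambda>t::real. f (z + of_real t * dir k)) has_vector_derivative pder k f (z + of_real t * dir k))
      (at t)" for z t
  proof -
    let ?y = "z + of_real t * dir k"
    have D: "(f has_derivative frechet_derivative f (at ?y)) (at ?y)"
      using f by (intro frechet tsmooth_differentiable)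
    have "((\<lambda>t::real. z + of_real t * dir k) has_derivative (\<lambda>t. of_real t * dir k)) (at t)"
      by (auto intro!: derivative_eq_intros)
    then have "((\<lambda>t::real. f (z + of_real t * dir k)) has_derivative
        (\<lambda>t. frechet_derivative f (at ?y) (of_real t * dir k))) (at t)"
      by (rule has_derivative_compose) (rule D)
    moreover have "frechet_derivative f (at ?y) (of_real t * dir k) = t *\<^sub>R pder k f ?y" for t
      using linear_scale[OF has_derivative_linear[OF D], of t "dir k"] pder_eq[OF D, of k]
      by (simp add: scaleR_conv_of_real)
    ultimately show ?thesis
      by (simp add: has_vector_derivative_def)
  qed
  have lim: "(\<lambda>n. q n z) \<longlonglongrightarrow> pder k f z" for z
  proof -
    let ?g = "\<lambda>t::real. f (z + of_real t * dir k)"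
    have "((\<lambda>t. (1 / \<bar>t\<bar>) *\<^sub>R (?g t - (f z + t *\<^sub>R pder k f z))) \<longlongrightarrow> 0) (at 0)"
      using vd[of z 0] unfolding has_vector_derivative_def has_derivative_at2 by simp
    then have "((\<lambda>t. norm ((1 / \<bar>t\<bar>) *\<^sub>R (?g t - (f z + t *\<^sub>R pder k f z)))) \<longlongrightarrow> 0) (at 0)"
      by (rule tendsto_norm_zero)
    moreover have "norm ((1 / \<bar>t\<bar>) *\<^sub>R (?g t - (f z + t *\<^sub>R pder k f z)))
        = norm ((?g t - f z) / of_real t - pder k f z)" if "t \<noteq> 0" for t
    proof -
      have "(?g t - f z) / of_real t - pder k f z = (?g t - (f z + t *\<^sub>R pder k f z)) / of_real t"
        using that by (simp add: diff_divide_distrib add_divide_distrib scaleR_conv_of_real)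
      then show ?thesis by (simp add: norm_divide)
    qed
    then have "\<forall>\<^sub>F t in at 0. norm ((1 / \<bar>t\<bar>) *\<^sub>R (?g t - (f z + t *\<^sub>R pder k f z)))
        = norm ((?g t - f z) / of_real t - pder k f z)"
      by (auto simp: eventually_at_filter)
    ultimately have "((\<lambda>t. norm ((?g t - f z) / of_real t - pder k f z)) \<longlongrightarrow> 0) (at 0)"
      by (rule Lim_transform_eventually)
    then have "((\<lambda>t. (?g t - f z) / of_real t) \<longlongrightarrow> pder k f z) (at 0)"
      by (subst Lim_null) (simp only: tendsto_norm_zero_iff)
    moreover have "filterlim h (at 0) sequentially"
      unfolding h_def using LIMSEQ_Suc[OF lim_1_over_n[where 'a = real]] by (intro filterlim_atI) auto
    ultimately show ?thesis
      unfolding q_def by (rule filterlim_compose)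
  qed
  have bound: "norm (q n z) \<le> B" for n z
  proof -
    have "norm (f (z + of_real (h n) * dir k) - f (z + of_real 0 * dir k)) \<le> B * norm (h n - 0)"
    proof (rule differentiable_bound[where f' = "\<lambda>t s. s *\<^sub>R pder k f (z + of_real t * dir k)" and S = UNIV])
      fix t :: real
      show "((\<lambda>t::real. f (z + of_real t * dir k)) has_derivative
          (\<lambda>s. s *\<^sub>R pder k f (z + of_real t * dir k))) (at t within UNIV)"
        using vd by (simp add: has_vector_derivative_def)
      show "onorm (\<lambda>s. s *\<^sub>R pder k f (z + of_real t * dir k)) \<le> B"
        using B by (intro onorm_bound) (auto simp: mult.commute[of B] intro: mult_left_mono)
    qed auto
    then show ?thesis
      using h[of n] by (simp add: q_def norm_divide divide_le_eq)
  qed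
  have tq: "tint (q n) = 0" for n
    using tint_diff[OF tcont_translate[OF tf] tf] tint_translate[OF tf]
    by (simp add: q_def divide_inverse mult.commute[of _ "inverse _"])
  have cq: "continuous_on UNIV (q n)" for n
    unfolding q_def using h[of n]
    by (intro continuous_on_divide tcontD(1)[OF tcont_translate[OF tf]] tcontD(1)[OF tf] continuous_on_diff
        continuous_on_const) auto
  have "(\<lambda>n. LINT z|lborel. indicator D z *\<^sub>R q n z) \<longlonglongrightarrow> (LINT z|lborel. indicator D z *\<^sub>R pder k f z)"
  proof (rule integral_dominated_convergence[where w = "\<lambda>z. indicator D z *\<^sub>R B"])
    show "integrable lborel (\<lambda>z. indicator D z *\<^sub>R B)"
      using integrable_D[of "\<lambda>_. B"] by (simp add: set_integrable_def)
    show "(\<lambda>z. indicator D z *\<^sub>R q n z) \<in> borel_measurable lborel" for n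
      using integrable_D[OF cq[of n]] by (simp add: set_integrable_def)
    show "(\<lambda>z. indicator D z *\<^sub>R pder k f z) \<in> borel_measurable lborel"
      using integrable_D[OF tcontD(1)[OF tp]] by (simp add: set_integrable_def)
    show "AE z in lborel. (\<lambda>n. indicator D z *\<^sub>R q n z) \<longlonglongrightarrow> indicator D z *\<^sub>R pder k f z"
      by (intro AE_I2 tendsto_intros lim)
    show "AE z in lborel. norm (indicator D z *\<^sub>R q n z) \<le> indicator D z *\<^sub>R B" for n
      using bound by (auto simp: indicator_def)
  qed
  then have "(\<lambda>n. tint (q n)) \<longlonglongrightarrow> tint (pder k f)"
    by (simp add: set_lebesgue_integral_def)
  then show ?thesis
    using tq by (simp add: LIMSEQ_const_iff)
qed

end

section \<open>Characters and uniqueness of Fourier coefficients\<close>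

context torus
begin

definition ch :: "int \<times> int \<Rightarrow> complex \<Rightarrow> complex" where
  "ch p z = exp (\<i> * of_real (2 * pi * (of_int (fst p) * c1 z + of_int (snd p) * c2 z)))"

text \<open>The exponent of \<open>ch p\<close> as a real linear function; differentiating
  \<open>ch p\<close> in direction v multiplies it by \<open>freq p v\<close>.\<close>

definition freq :: "int \<times> int \<Rightarrow> complex \<Rightarrow> complex" where
  "freq p v = 2 * pi * \<i> * (of_int (fst p) * of_real (c1 v) + of_int (snd p) * of_real (c2 v))"

lemma ch_add: "ch (p + q) z = ch p z * ch q z"
  by (simp add: ch_def exp_add[symmetric] algebra_simps)

lemma ch_translate: "ch p (z + v) = ch p z * ch p v"
  by (simp add: ch_def exp_add[symmetric] algebra_simps)

lemma ch_0 [simp]: "ch 0 z = 1" by (simp add: ch_def)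

lemma norm_ch [simp]: "norm (ch p z) = 1"
  unfolding ch_def by (rule norm_exp_i_times)

lemma ch_minus: "ch (- p) z = cnj (ch p z)"
  by (simp add: ch_def exp_cnj algebra_simps)

lemma exp_2pi_int: "exp (\<i> * of_real (2 * pi * of_int n)) = 1"
  using exp_integer_2pi[of "of_int n"] by (simp add: mult_ac)

lemma ch_periods [simp]: "ch p w1 = 1" "ch p w2 = 1"
  using exp_2pi_int by (simp_all add: ch_def)

lemma freq_linear: "bounded_linear (freq p)"
  unfolding freq_def[abs_def]
  by (intro bounded_linear_compose[OF bounded_linear_mult_right] bounded_linear_add
      bounded_linear_compose[OF bounded_linear_of_real] bounded_linear_c1 bounded_linear_c2)

lemma ch_has_derivative: "(ch p has_derivative (\<lambda>v. ch p z * freq p v)) (at z)"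
proof -
  have "(freq p has_derivative freq p) (at z)"
    using bounded_linear_imp_has_derivative freq_linear by blast
  from has_derivative_exp_comp[OF this]
  have "((\<lambda>z. exp (freq p z)) has_derivative (\<lambda>v. exp (freq p z) * freq p v)) (at z)" .
  moreover have "exp (freq p z) = ch p z" for z
    by (simp add: ch_def freq_def algebra_simps)
  ultimately show ?thesis by simp
qed

lemma pder_ch: "pder k (ch p) = (\<lambda>z. freq p (dir k) * ch p z)"
  by (simp add: fun_eq_iff pder_eq[OF ch_has_derivative])

lemma ch_differentiable: "ch p differentiable (at z)"
  using ch_has_derivative unfolding differentiable_def by blast

text \<open>The constant factor is there for the coinduction: the multiples of a character are
  closed under partial derivatives, a single character is not.\<close>

lemma tsmooth_cmult_ch: "tsmooth (\<lambda>z. c * ch p z)"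
proof (rule tsmooth_coinduct[of "\<lambda>f. \<exists>c. f = (\<lambda>z. c * ch p z)"])
  fix g assume "\<exists>c. g = (\<lambda>z. c * ch p z)"
  then obtain c where g: "g = (\<lambda>z. c * ch p z)" by blast
  have "pder k g = (\<lambda>z. (c * freq p (dir k)) * ch p z)" for k
    unfolding g by (simp add: fun_eq_iff pder_cmult[OF ch_differentiable] pder_ch)
  moreover have "g differentiable (at z)" for z
    unfolding g by (intro differentiable_mult differentiable_const ch_differentiable)
  ultimately show "(\<forall>z. g differentiable (at z)) \<and> (\<forall>k. \<exists>c. pder k g = (\<lambda>z. c * ch p z))"
    by blast
qed blast

lemma tsmooth_ch: "tsmooth (ch p)"
  using tsmooth_cmult_ch[of 1 p] by simp

lemma periodic_ch: "lattice_periodic w1 w2 (ch p)"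
  by (simp add: lattice_periodic_def ch_translate)

lemma tcont_smooth: "tsmooth f \<Longrightarrow> lattice_periodic w1 w2 f \<Longrightarrow> tcont f"
  by (simp add: tcont_def continuous_on_tsmooth)

lemma tcont_ch: "tcont (ch p)"
  by (intro tcont_smooth tsmooth_ch periodic_ch)

definition area :: real where "area = measure lborel D"

lemma tint_const: "tint (\<lambda>z. c) = c * of_real area"
  by (simp add: set_lebesgue_integral_def area_def scaleR_conv_of_real mult.commute)

text \<open>No area formula is required: if the measure were 0, the constant 1 would be a
  nonnegative function of integral 0, hence 0.\<close>

lemma area_pos: "area > 0"
proof -
  have "area \<noteq> 0"
    using tint_nonneg_eq_0[of "\<lambda>_. 1"] tint_const[of 1] tcont_const[of 1] by auto
  then show ?thesis unfolding area_def by (simp add: less_le)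
qed

text \<open>A nontrivial character takes the value -1 at a suitable fraction of a period;
  translating by that vector changes the sign of the integral but not its value.\<close>

lemma tint_ch: "tint (ch p) = (if p = 0 then of_real area else 0)"
proof (cases "p = 0")
  case False
  have "\<exists>v. ch p v = -1"
  proof (cases "fst p = 0")
    case True
    with False have "snd p \<noteq> 0" by (auto simp: prod_eq_iff)
    then have "ch p (of_real (1 / (2 * of_int (snd p))) * w2) = exp (\<i> * pi)"
      unfolding ch_def c1_scale c2_scale c_basis by (simp add: field_simps)
    then show ?thesis by (metis exp_pi_i mult.commute)
  next
    case False
    then have "ch p (of_real (1 / (2 * of_int (fst p))) * w1) = exp (\<i> * pi)"
      unfolding ch_def c1_scale c2_scale c_basis by (simp add: field_simps)
    then show ?thesis by (metis exp_pi_i mult.commute)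
  qed
  then obtain v where v: "ch p v = -1" by blast
  have "tint (ch p) = tint (\<lambda>z. ch p (z + v))"
    by (rule tint_translate[OF tcont_ch, symmetric])
  also have "\<dots> = tint (\<lambda>z. -1 * ch p z)"
    by (simp add: ch_translate v)
  also have "\<dots> = - tint (ch p)"
    by (subst set_integral_mult_right) simp
  finally show ?thesis using False by simp
qed (use tint_const[of 1] in simp)

text \<open>Not divided by the area of the cell; the factor \<open>area\<close> therefore reappears
  in \<open>coef_four\<close> and wherever a function is recovered from its coefficients.\<close>

definition coef :: "(complex \<Rightarrow> complex) \<Rightarrow> int \<times> int \<Rightarrow> complex" where
  "coef f p = tint (\<lambda>z. f z * ch (- p) z)"

lemma coef_ch: "coef (ch q) p = (if p = q then of_real area else 0)"
proof -
  have "(\<lambda>z. ch q z * ch (- p) z) = ch (q - p)"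
    by (simp add: fun_eq_iff ch_add[symmetric])
  then show ?thesis
    by (simp add: coef_def tint_ch)
qed

lemma coef_cmult: "coef (\<lambda>z. c * f z) p = c * coef f p"
  by (simp add: coef_def mult.assoc)

lemma coef_add: "tcont f \<Longrightarrow> tcont g \<Longrightarrow> coef (\<lambda>z. f z + g z) p = coef f p + coef g p"
  unfolding coef_def distrib_right by (intro tint_add tcont_mult tcont_ch)

lemma coef_diff: "tcont f \<Longrightarrow> tcont g \<Longrightarrow> coef (\<lambda>z. f z - g z) p = coef f p - coef g p"
  unfolding coef_def left_diff_distrib by (intro tint_diff tcont_mult tcont_ch)

lemma norm_coef_le:
  assumes "tcont f" "\<And>z. norm (f z) \<le> B"
  shows "norm (coef f p) \<le> B * area"
  unfolding coef_def area_def
  by (intro norm_tint_le tcont_mult tcont_ch assms) (simp only: norm_mult norm_ch mult_1_right assms)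

text \<open>Integration by parts: the derivative of f times a character has integral 0.\<close>

lemma coef_pder:
  assumes f: "tsmooth f" "lattice_periodic w1 w2 f"
  shows "coef (pder k f) p = freq p (dir k) * coef f p"
proof -
  let ?g = "\<lambda>z. f z * ch (- p) z"
  have tc: "tcont (pder k f)" "tcont f"
    using f by (auto intro!: tcont_smooth tsmooth_pder periodic_pder)
  have neg: "freq (- p) v = - freq p v" for v
    by (simp add: freq_def algebra_simps)
  have "tsmooth ?g" by (intro tsmooth_mult f tsmooth_ch)
  moreover have "lattice_periodic w1 w2 ?g"
    using f(2) periodic_ch[of "- p"] by (simp add: lattice_periodic_def)
  ultimately have "0 = tint (pder k ?g)"
    by (simp add: tint_pder)
  also have "pder k ?g = (\<lambda>z. pder k f z * ch (- p) z - freq p (dir k) * (f z * ch (- p) z))"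
    by (simp add: fun_eq_iff pder_mult[OF tsmooth_differentiable[OF f(1)] ch_differentiable] pder_ch neg)
  also have "tint \<dots> = coef (pder k f) p - tint (\<lambda>z. freq p (dir k) * (f z * ch (- p) z))"
    unfolding coef_def by (intro tint_diff tcont_mult tcont_const tc tcont_ch)
  also have "tint (\<lambda>z. freq p (dir k) * (f z * ch (- p) z)) = freq p (dir k) * coef f p"
    by (simp add: coef_def)
  finally show ?thesis by simp
qed

section \<open>Trigonometric polynomials and their density\<close>

inductive trig :: "(complex \<Rightarrow> complex) \<Rightarrow> bool" where
  single: "trig (\<lambda>z. c * ch p z)"
| add: "trig f \<Longrightarrow> trig g \<Longrightarrow> trig (\<lambda>z. f z + g z)"

lemma trig_const: "trig (\<lambda>z. c)"
  using trig.single[of c 0] by simp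

lemma trig_mult: "trig f \<Longrightarrow> trig g \<Longrightarrow> trig (\<lambda>z. f z * g z)"
proof (induction rule: trig.induct)
  case (single c p)
  from single show ?case
  proof (induction rule: trig.induct)
    case (single d q)
    have "(\<lambda>z. c * ch p z * (d * ch q z)) = (\<lambda>z. (c * d) * ch (p + q) z)"
      by (simp add: fun_eq_iff ch_add)
    then show ?case by (simp only: trig.single)
  qed (auto simp: distrib_left intro: trig.add)
qed (auto simp: distrib_right intro: trig.add)

lemma trig_cmult: "trig f \<Longrightarrow> trig (\<lambda>z. c * f z)"
  by (rule trig_mult[OF trig_const])

lemma trig_tcont: "trig f \<Longrightarrow> tcont f"
  by (induction rule: trig.induct) (auto intro: tcont_add tcont_mult tcont_const tcont_ch)

lemma trig_orthogonal:
  assumes f: "tcont f" "\<And>p. coef f p = 0"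
  shows "trig g \<Longrightarrow> tint (\<lambda>z. f z * g z) = 0"
proof (induction rule: trig.induct)
  case (single c p)
  have "(\<lambda>z. f z * (c * ch p z)) = (\<lambda>z. c * (f z * ch (- (- p)) z))"
    by (simp add: fun_eq_iff)
  then show ?case
    using f(2)[of "- p"] unfolding coef_def by simp
next
  case (add g h)
  then show ?case
    unfolding distrib_left using f by (subst tint_add) (auto intro: tcont_mult trig_tcont)
qed

text \<open>Realizes the torus as a product of two unit circles. Its fibres are the lattice cosets,
  so periodic functions become functions on a compact set, where polynomials are dense; polynomials
  composed with \<open>emb\<close> are trigonometric.\<close>

definition emb :: "complex \<Rightarrow> complex \<times> complex" where
  "emb z = (ch (1,0) z, ch (0,1) z)"

lemma trig_Re: "trig (\<lambda>z. of_real (Re (ch p z)))"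
proof -
  have "(\<lambda>z. complex_of_real (Re (ch p z))) = (\<lambda>z. 1/2 * ch p z + 1/2 * ch (- p) z)"
    by (simp add: fun_eq_iff ch_minus complex_eq_iff)
  then show ?thesis by (simp only: trig.intros)
qed

lemma trig_Im: "trig (\<lambda>z. of_real (Im (ch p z)))"
proof -
  have "(\<lambda>z. complex_of_real (Im (ch p z))) = (\<lambda>z. (- \<i>/2) * ch p z + \<i>/2 * ch (- p) z)"
    by (simp add: fun_eq_iff ch_minus complex_eq_iff)
  then show ?thesis by (simp only: trig.intros)
qed

lemma trig_real_polynomial:
  "real_polynomial_function g \<Longrightarrow> trig (\<lambda>z. of_real (g (emb z)))"
proof (induction rule: real_polynomial_function.induct)
  case (linear f)
  have lin: "linear f" using linear by (rule bounded_linear.linear)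
  have "f (emb z) = f (1,0) * Re (ch (1,0) z) + f (\<i>,0) * Im (ch (1,0) z)
      + (f (0,1) * Re (ch (0,1) z) + f (0,\<i>) * Im (ch (0,1) z))" for z
  proof -
    have "emb z = Re (ch (1,0) z) *\<^sub>R (1,0) + Im (ch (1,0) z) *\<^sub>R (\<i>,0)
      + (Re (ch (0,1) z) *\<^sub>R (0,1) + Im (ch (0,1) z) *\<^sub>R (0,\<i>))"
      by (simp add: emb_def complex_eq_iff)
    then show ?thesis
      by (simp only: linear_add[OF lin] linear_scale[OF lin]) (simp add: mult_ac)
  qed
  then show ?case
    by (simp del: One_nat_def) (intro trig.add trig_cmult trig_Re trig_Im)
next
  case (const c)
  then show ?case by (rule trig_const)
qed (auto intro: trig.add trig_mult)

lemma trig_polynomial: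
  assumes "polynomial_function g"
  shows "trig (\<lambda>z. g (emb z))"
proof -
  have "real_polynomial_function (Re \<circ> g)" "real_polynomial_function (Im \<circ> g)"
    using assms bounded_linear_Re bounded_linear_Im by (auto simp: polynomial_function_def)
  then have "trig (\<lambda>z. of_real (Re (g (emb z))) + \<i> * of_real (Im (g (emb z))))"
    using trig_real_polynomial by (intro trig.add trig_cmult) fastforce+
  then show ?thesis by (simp add: complex_eq[symmetric])
qed

lemma exp_i_eq_int:
  assumes "exp (\<i> * of_real (2 * pi * x)) = exp (\<i> * of_real (2 * pi * y))"
  obtains n :: int where "x = y + of_int n"
proof -
  from assms obtain n :: int where "\<i> * of_real (2 * pi * x) = \<i> * of_real (2 * pi * y) + (of_int (2 * n) * pi) * \<i>"
    using exp_eq by blast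
  then have "Im (\<i> * of_real (2 * pi * x)) = Im (\<i> * of_real (2 * pi * y) + (of_int (2 * n) * pi) * \<i>)"
    by simp
  then have "2 * pi * x = 2 * pi * (y + of_int n)"
    by (simp add: algebra_simps)
  then have "x = y + of_int n"
    by simp
  then show ?thesis by (rule that)
qed

lemma emb_eq:
  assumes "emb z = emb z'" and f: "lattice_periodic w1 w2 f"
  shows "f z = f z'"
proof -
  have "ch (1,0) z = ch (1,0) z'" "ch (0,1) z = ch (0,1) z'"
    using assms(1) by (simp_all only: emb_def prod.inject)
  then have "exp (\<i> * of_real (2 * pi * c1 z)) = exp (\<i> * of_real (2 * pi * c1 z'))"
    "exp (\<i> * of_real (2 * pi * c2 z)) = exp (\<i> * of_real (2 * pi * c2 z'))"
    by (simp_all only: ch_def fst_conv snd_conv of_int_0 of_int_1 mult_1_left mult_zero_left add_0_left add_0_right)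
  then obtain j k :: int where "c1 z = c1 z' + of_int j" "c2 z = c2 z' + of_int k"
    by (elim exp_i_eq_int)
  then have "z = z' + of_int j * w1 + of_int k * w2"
    using coords[of z] coords[of z'] by (simp add: algebra_simps)
  then show ?thesis using periodic_lattice[OF f] by simp
qed

lemma trig_dense:
  assumes f: "tcont f" and e: "e > 0"
  obtains g where "trig g" "\<And>z. norm (f z - g z) < e"
proof -
  define F where "F y = f (SOME z. emb z = y)" for y
  have F: "F (emb z) = f z" for z
    unfolding F_def by (rule emb_eq[OF _ tcontD(2)[OF f]]) (rule someI, rule refl)
  have cemb: "continuous_on A emb" for A
    unfolding emb_def using tcontD(1)[OF tcont_ch] by (intro continuous_intros) (auto intro: continuous_on_subset)
  have compact: "compact (emb ` K)"
    by (intro compact_continuous_image compact_K cemb)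
  \<comment> \<open>The choice made in \<open>F\<close> is harmless because f is constant on the
    fibres. Continuity of \<open>F\<close> comes from compactness: \<open>emb\<close> maps closed
    parts of \<open>K\<close> to closed sets.\<close>
  have "closed (F -` C \<inter> emb ` K)" if "closed C" for C
  proof -
    have "F -` C \<inter> emb ` K = emb ` (K \<inter> f -` C)"
      using F by auto
    moreover have "compact (K \<inter> f -` C)"
      using that compact_K tcontD(1)[OF f] by (intro compact_Int_closed closed_vimage) auto
    ultimately show ?thesis
      by (simp add: compact_continuous_image cemb compact_imp_closed)
  qed
  then have "continuous_on (emb ` K) F"
    using continuous_on_closed_vimage[OF compact_imp_closed[OF compact]] by blast
  from Stone_Weierstrass_polynomial_function[OF compact this e]
  obtain g where g: "polynomial_function g" "\<And>y. y \<in> emb ` K \<Longrightarrow> norm (F y - g y) < e"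
    by blast
  have "emb z \<in> emb ` K" for z
  proof -
    let ?z = "of_real (frac (c1 z)) * w1 + of_real (frac (c2 z)) * w2"
    have "ch p z = ch p ?z" for p
      using periodic_frac[OF periodic_ch, of p 0 z] by simp
    then have "emb z = emb ?z" by (simp add: emb_def)
    moreover have "?z \<in> K"
      unfolding K_def by (rule image_eqI[of _ _ "(frac (c1 z), frac (c2 z))"])
        (auto simp: less_imp_le[OF frac_lt_1])
    ultimately show ?thesis by blast
  qed
  then have "norm (f z - g (emb z)) < e" for z
    using g(2)[of "emb z"] F by simp
  then show ?thesis
    using that[OF trig_polynomial[OF g(1)]] by blast
qed

text \<open>Since f is orthogonal to all trigonometric polynomials, one that is uniformly close to
  \<open>cnj (f z)\<close> may be subtracted from it in the integral of the squared modulus, which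
  is thus arbitrarily small.\<close>

lemma coef_unique_0:
  assumes f: "tcont f" and zero: "\<And>p. coef f p = 0"
  shows "f z = 0"
proof -
  let ?q = "\<lambda>z. (norm (f z))\<^sup>2"
  obtain B where B: "0 < B" "\<And>z. norm (f z) \<le> B"
    using tcont_bounded[OF f] by metis
  have q: "(\<lambda>z. of_real (?q z)) = (\<lambda>z. f z * cnj (f z))"
    by (simp add: fun_eq_iff complex_norm_square del: of_real_power)
  have "norm (tint (\<lambda>z. of_real (?q z))) \<le> e" if "e > 0" for e
  proof -
    define d where "d = e / (B * area)"
    have "d > 0" using that B(1) area_pos by (simp add: d_def)
    from trig_dense[OF tcont_cnj[OF f] this]
    obtain g where g: "trig g" "\<And>z. norm (cnj (f z) - g z) < d" by blast
    have g': "tcont g" using g(1) by (rule trig_tcont)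
    have "tint (\<lambda>z. of_real (?q z)) = tint (\<lambda>z. f z * (cnj (f z) - g z) + f z * g z)"
      unfolding q by (simp add: algebra_simps)
    also have "\<dots> = tint (\<lambda>z. f z * (cnj (f z) - g z))"
      using trig_orthogonal[OF f zero g(1)] f g'
      by (subst tint_add) (auto intro!: tcont_mult tcont_diff tcont_cnj)
    also have "norm \<dots> \<le> (B * d) * area"
      unfolding area_def using f g' g(2) B
      by (intro norm_tint_le) (auto intro!: tcont_mult tcont_diff tcont_cnj mult_mono
        simp: norm_mult less_imp_le)
    also have "\<dots> = e"
      using B(1) area_pos by (simp add: d_def)
    finally show ?thesis .
  qed
  then have "tint (\<lambda>z. of_real (?q z)) = 0"
    using field_le_epsilon[of "norm (tint (\<lambda>z. of_real (?q z)))" 0] by auto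
  moreover have "tcont (\<lambda>z. of_real (?q z))"
    unfolding q by (intro tcont_mult tcont_cnj f)
  ultimately have "?q z = 0"
    by (intro tint_nonneg_eq_0) auto
  then show ?thesis by simp
qed

lemma coef_unique:
  assumes "tcont f" "tcont g" "\<And>p. coef f p = coef g p"
  shows "f = g"
  using coef_unique_0[OF tcont_diff[OF assms(1,2)]] assms by (auto simp: fun_eq_iff coef_diff)

end

section \<open>Fourier series and the equation dbar f = h\<close>

definition height :: "int \<times> int \<Rightarrow> real" where
  "height p = 1 + of_int \<bar>fst p\<bar> + of_int \<bar>snd p\<bar>"

lemma height_ge_1: "height p \<ge> 1"
  by (simp add: height_def)

text \<open>The integers are covered by two copies of the naturals; their overlap at 0 does no harm
  to absolute summability.\<close>

lemma summable_int_square: "Infinite_Set_Sum.abs_summable_on (\<lambda>j::int. 1 / (1 + of_int \<bar>j\<bar>)\<^sup>2 :: real) UNIV"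
proof -
  have "summable (\<lambda>n. 1 / (1 + real n)\<^sup>2)"
    using summable_Suc_iff[THEN iffD2, OF inverse_power_summable[of 2, where 'a = real]]
    by (simp add: inverse_eq_divide)
  then have nat: "Infinite_Set_Sum.abs_summable_on (\<lambda>n. 1 / (1 + real n)\<^sup>2) UNIV"
    by (simp add: abs_summable_on_nat_iff')
  have "Infinite_Set_Sum.abs_summable_on (\<lambda>j::int. 1 / (1 + of_int \<bar>j\<bar>)\<^sup>2 :: real) (range int \<union> range (\<lambda>n. - int n))"
    using nat by (intro abs_summable_on_union abs_summable_on_reindex) simp_all
  also have "range int \<union> range (\<lambda>n. - int n) = UNIV"
  proof -
    have "j \<in> range int \<union> range (\<lambda>n. - int n)" for j :: int
      by (cases j rule: int_cases2) auto
    then show ?thesis by blast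
  qed
  finally show ?thesis .
qed

text \<open>The height dominates both 1 + |j| and 1 + |k|, so its fourth power dominates the product
  of their squares and the double series is compared with a product of two single ones.\<close>

lemma abs_summable_height: "Infinite_Set_Sum.abs_summable_on (\<lambda>p. 1 / height p ^ 4) UNIV"
proof -
  let ?u = "\<lambda>j::int. 1 / (1 + of_int \<bar>j\<bar>)\<^sup>2 :: real"
  have "Infinite_Set_Sum.abs_summable_on (\<lambda>(j,k). ?u j * ?u k) (UNIV \<times> UNIV)"
    by (intro abs_summable_on_product summable_int_square) auto
  then have "Infinite_Set_Sum.abs_summable_on (\<lambda>(j,k). ?u j * ?u k) UNIV" by simp
  then show ?thesis
  proof (rule abs_summable_on_comparison_test')
    fix p :: "int \<times> int"
    obtain j k where p: "p = (j,k)" by (cases p)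
    have "(1 + of_int \<bar>j\<bar>)\<^sup>2 * (1 + of_int \<bar>k\<bar>)\<^sup>2 \<le> height p ^ 2 * height p ^ 2"
      by (intro mult_mono power_mono) (auto simp: height_def p)
    also have "\<dots> = height p ^ 4" by (simp flip: power_add)
    finally have "(1 + of_int \<bar>j\<bar>)\<^sup>2 * (1 + of_int \<bar>k\<bar>)\<^sup>2 \<le> height p ^ 4" .
    moreover have h: "height p > 0" using height_ge_1[of p] by linarith
    moreover have "(0::real) < (1 + of_int \<bar>j\<bar>)\<^sup>2 * (1 + of_int \<bar>k\<bar>)\<^sup>2"
      by (intro mult_pos_pos zero_less_power) auto
    ultimately have "1 / height p ^ 4 \<le> 1 / ((1 + of_int \<bar>j\<bar>)\<^sup>2 * (1 + of_int \<bar>k\<bar>)\<^sup>2)"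
      by (intro divide_left_mono mult_pos_pos) auto
    with h show "norm (1 / height p ^ 4) \<le> (case p of (j, k) \<Rightarrow> ?u j * ?u k)"
      by (simp add: p)
  qed
qed

text \<open>Turns sums over frequencies into ordinary series, for which termwise differentiation and
  integration are at hand. The series with rapidly decreasing coefficients converge absolutely, so
  any enumeration will do.\<close>

definition enum :: "nat \<Rightarrow> int \<times> int" where
  "enum = from_nat_into UNIV"

lemma bij_enum: "bij enum"
  unfolding enum_def by (rule bij_betw_from_nat_into) (auto simp: finite_prod)

lemma summable_height: "summable (\<lambda>n. 1 / height (enum n) ^ 4)"
proof -
  have "Infinite_Set_Sum.abs_summable_on (\<lambda>n. 1 / height (enum n) ^ 4) UNIV"
    using abs_summable_height by (subst abs_summable_on_reindex_bij_betw[OF bij_enum])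
  then show ?thesis
    using summable_norm_cancel by (auto simp: abs_summable_on_nat_iff')
qed

text \<open>The decay that characterizes smooth functions: \<open>rapid_coef\<close> and
  \<open>tsmooth_four\<close> give the two directions.\<close>

definition rapid :: "(int \<times> int \<Rightarrow> complex) \<Rightarrow> bool" where
  "rapid a \<longleftrightarrow> (\<forall>N. \<exists>M. \<forall>p. norm (a p) * height p ^ N \<le> M)"

lemma rapid_summable:
  assumes "rapid a"
  shows "summable (\<lambda>n. norm (a (enum n)) * height (enum n))"
proof -
  \<comment> \<open>The exponent 5 is 4 for the convergence in \<open>summable_height\<close> and 1
    for the factor \<open>height\<close> in the claim, the cost of one derivative.\<close>
  obtain M where M: "\<And>p. norm (a p) * height p ^ 5 \<le> M"
    using assms unfolding rapid_def by blast
  show ?thesis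
  proof (rule summable_comparison_test')
    show "summable (\<lambda>n. M * (1 / height (enum n) ^ 4))"
      by (intro summable_mult summable_height)
    fix n
    let ?h = "height (enum n)"
    have h: "?h > 0" using height_ge_1[of "enum n"] by linarith
    have "norm (a (enum n)) * ?h = (norm (a (enum n)) * ?h ^ 5) * (1 / ?h ^ 4)"
      using h by (simp add: field_simps numeral_eq_Suc)
    also have "\<dots> \<le> M * (1 / ?h ^ 4)"
      using h by (intro mult_right_mono M) auto
    finally show "norm (norm (a (enum n)) * ?h) \<le> M * (1 / ?h ^ 4)"
      using h by simp
  qed
qed

lemma rapid_summable_norm:
  assumes "rapid a"
  shows "summable (\<lambda>n. norm (a (enum n)))"
proof (rule summable_comparison_test'[OF rapid_summable[OF assms]])
  show "norm (norm (a (enum n))) \<le> norm (a (enum n)) * height (enum n)" for n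
    using mult_left_mono[OF height_ge_1, of "norm (a (enum n))"] by simp
qed

text \<open>Serves opposite purposes: multiplication by \<open>freq\<close>, which differentiates,
  and division by the symbol of \<open>dbar\<close>, which inverts the operator.\<close>

lemma rapid_mult:
  assumes a: "rapid a" and g: "\<And>p. norm (g p) \<le> C * height p"
  shows "rapid (\<lambda>p. g p * a p)"
  unfolding rapid_def
proof
  fix N
  obtain M where M: "\<And>p. norm (a p) * height p ^ Suc N \<le> M"
    using a unfolding rapid_def by blast
  \<comment> \<open>Read off from the bound at the frequency 0, where the height is 1.\<close>
  have C: "0 \<le> C"
    using order_trans[OF norm_ge_zero g[of 0]] by (simp add: height_def)
  have "norm (g p * a p) * height p ^ N \<le> C * M" for p
  proof -
    have "norm (g p * a p) * height p ^ N \<le> (C * height p) * norm (a p) * height p ^ N"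
      unfolding norm_mult using g[of p] height_ge_1[of p] by (intro mult_right_mono) auto
    also have "\<dots> = C * (norm (a p) * height p ^ Suc N)" by simp
    also have "\<dots> \<le> C * M" using M C by (intro mult_left_mono)
    finally show ?thesis .
  qed
  then show "\<exists>M. \<forall>p. norm (g p * a p) * height p ^ N \<le> M" by blast
qed

section \<open>Termwise calculus of Fourier series\<close>

context torus
begin

lemma freq_bound:
  obtains C where "C > 0" "\<And>p. norm (freq p v) \<le> C * height p"
proof
  let ?C = "2 * pi * (\<bar>c1 v\<bar> + \<bar>c2 v\<bar>) + 1"
  show "?C > 0" by (smt (verit) abs_ge_zero mult_nonneg_nonneg pi_gt_zero)
  fix p
  have "norm (freq p v) = 2 * pi * norm (of_int (fst p) * complex_of_real (c1 v) + of_int (snd p) * of_real (c2 v))"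
    by (simp add: freq_def norm_mult)
  also have "\<dots> \<le> 2 * pi * (\<bar>of_int (fst p)\<bar> * \<bar>c1 v\<bar> + \<bar>of_int (snd p)\<bar> * \<bar>c2 v\<bar>)"
    by (intro mult_left_mono order_trans[OF norm_triangle_ineq]) (auto simp: norm_mult)
  also have "\<dots> \<le> 2 * pi * (height p * \<bar>c1 v\<bar> + height p * \<bar>c2 v\<bar>)"
    by (intro mult_left_mono add_mono mult_right_mono) (auto simp: height_def)
  also have "\<dots> \<le> ?C * height p"
    using height_ge_1[of p] by (simp add: algebra_simps)
  finally show "norm (freq p v) \<le> ?C * height p" .
qed

definition four :: "(int \<times> int \<Rightarrow> complex) \<Rightarrow> complex \<Rightarrow> complex" where
  "four a z = (\<Sum>n. a (enum n) * ch (enum n) z)"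

lemma four_summable: "rapid a \<Longrightarrow> summable (\<lambda>n. a (enum n) * ch (enum n) z)"
  by (rule summable_norm_cancel) (simp add: norm_mult rapid_summable_norm)

lemma rapid_freq:
  assumes "rapid a" shows "rapid (\<lambda>p. freq p v * a p)"
proof -
  obtain C where "C > 0" "\<And>p. norm (freq p v) \<le> C * height p"
    by (rule freq_bound[of v]) blast
  with assms show ?thesis by (intro rapid_mult)
qed

lemma norm_freq_le:
  obtains C where "C > 0" "\<And>p v. norm (freq p v) \<le> C * height p * norm v"
proof -
  obtain A where A: "A > 0" "\<And>p. norm (freq p 1) \<le> A * height p" by (rule freq_bound[of 1]) blast
  obtain B where B: "B > 0" "\<And>p. norm (freq p \<i>) \<le> B * height p" by (rule freq_bound[of \<i>]) blast
  have "norm (freq p v) \<le> (A + B) * height p * norm v" for p v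
  proof -
    have lin: "linear (freq p)" using freq_linear by (rule bounded_linear.linear)
    have "v = Re v *\<^sub>R 1 + Im v *\<^sub>R \<i>" by (simp add: complex_eq_iff)
    then have "freq p v = Re v *\<^sub>R freq p 1 + Im v *\<^sub>R freq p \<i>"
      using linear_add[OF lin] linear_scale[OF lin] by metis
    then have "norm (freq p v) \<le> \<bar>Re v\<bar> * norm (freq p 1) + \<bar>Im v\<bar> * norm (freq p \<i>)"
      by (metis norm_triangle_ineq norm_scaleR)
    also have "\<dots> \<le> norm v * (A * height p) + norm v * (B * height p)"
      using A B by (intro add_mono mult_mono abs_Re_le_cmod abs_Im_le_cmod) auto
    finally show ?thesis by (simp add: algebra_simps)
  qed
  then show ?thesis using A(1) B(1) that[of "A + B"] by simp
qed

text \<open>The n-th derivative term is at most \<open>d n * norm v\<close>, uniformly in z, with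
  \<open>d\<close> summable because one power of the height is affordable. The tails of
  \<open>d\<close> supply the uniform convergence that termwise differentiation demands.\<close>

lemma four_has_derivative:
  assumes a: "rapid a"
  shows "(four a has_derivative (\<lambda>v. \<Sum>n. a (enum n) * (ch (enum n) z * freq (enum n) v))) (at z)"
proof -
  obtain C where C: "C > 0" "\<And>p v. norm (freq p v) \<le> C * height p * norm v"
    by (rule norm_freq_le) blast
  define d where "d n = C * (norm (a (enum n)) * height (enum n))" for n
  have d: "summable d"
    unfolding d_def by (intro summable_mult rapid_summable a)
  define f where "f = (\<lambda>n z. a (enum n) * ch (enum n) z)"
  define f' where "f' = (\<lambda>n z v. a (enum n) * (ch (enum n) z * freq (enum n) v))"
  have le: "norm (f' n z v) \<le> d n * norm v" for n z v
    using mult_left_mono[OF C(2)[of "enum n" v], of "norm (a (enum n))"]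
    by (simp add: f'_def d_def norm_mult mult_ac)
  have sm: "summable (\<lambda>n. f' n z v)" for z v
    by (rule summable_comparison_test'[OF summable_mult2[OF d] le])
  have "\<exists>g. \<forall>x\<in>UNIV. (\<lambda>n. f n x) sums g x \<and> (g has_derivative (\<lambda>v. \<Sum>n. f' n x v)) (at x within UNIV)"
  proof (rule has_derivative_series)
    show "(f n has_derivative f' n z) (at z within UNIV)" for n z
      unfolding f_def f'_def using has_derivative_mult_right[OF ch_has_derivative] by simp
    show "(\<lambda>n. f n 0) sums four a 0"
      unfolding f_def four_def by (intro summable_sums four_summable a)
    fix e :: real assume "e > 0"
    from suminf_exist_split[OF this d] obtain N where N: "\<And>n. n \<ge> N \<Longrightarrow> norm (\<Sum>i. d (i + n)) < e"
      by blast
    have "norm ((\<Sum>i<n. f' i z v) - (\<Sum>i. f' i z v)) \<le> e * norm v" if "n \<ge> N" for n z v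
    proof -
      have "norm ((\<Sum>i<n. f' i z v) - (\<Sum>i. f' i z v)) = norm (\<Sum>i. f' (i + n) z v)"
        by (subst suminf_minus_initial_segment[OF sm]) (simp add: norm_minus_commute)
      also have "\<dots> \<le> (\<Sum>i. d (i + n) * norm v)"
        by (rule norm_suminf_le) (use le d in \<open>auto intro!: summable_mult2 simp: summable_iff_shift\<close>)
      also have "\<dots> = (\<Sum>i. d (i + n)) * norm v"
        using d by (intro suminf_mult2[symmetric]) (simp add: summable_iff_shift)
      also have "\<dots> \<le> e * norm v"
        using N[OF that] by (intro mult_right_mono) auto
      finally show ?thesis .
    qed
    then show "\<forall>\<^sub>F n in sequentially. \<forall>z\<in>UNIV. \<forall>v. norm ((\<Sum>i<n. f' i z v) - (\<Sum>i. f' i z v)) \<le> e * norm v"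
      unfolding eventually_sequentially by blast
  qed auto
  then obtain g where g: "\<And>x. (\<lambda>n. f n x) sums g x"
      "\<And>x. (g has_derivative (\<lambda>v. \<Sum>n. f' n x v)) (at x)"
    by auto
  have "g = four a"
    using sums_unique[OF g(1)] by (auto simp: four_def f_def)
  with g(2)[of z] show ?thesis by (simp add: f'_def)
qed

lemma pder_four:
  assumes "rapid a"
  shows "pder k (four a) = four (\<lambda>p. freq p (dir k) * a p)"
  by (simp add: fun_eq_iff pder_eq[OF four_has_derivative[OF assms]]) (simp add: four_def mult_ac)

lemma tsmooth_four:
  assumes "rapid a"
  shows "tsmooth (four a)"
proof (rule tsmooth_coinduct[of "\<lambda>f. \<exists>a. rapid a \<and> f = four a"])
  show "(\<forall>z. g differentiable (at z)) \<and> (\<forall>k. \<exists>a. rapid a \<and> pder k g = four a)"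
    if ex: "\<exists>a. rapid a \<and> g = four a" for g
  proof -
    obtain a where a: "rapid a" "g = four a" using ex by blast
    have "g differentiable (at z)" for z
      unfolding a(2) differentiable_def using four_has_derivative[OF a(1)] by blast
    moreover have "rapid (\<lambda>p. freq p (dir k) * a p) \<and> pder k g = four (\<lambda>p. freq p (dir k) * a p)" for k
      unfolding a(2) by (intro conjI rapid_freq pder_four a(1))
    ultimately show ?thesis by blast
  qed
qed (use assms in blast)

lemma periodic_four: "lattice_periodic w1 w2 (four a)"
  by (simp add: lattice_periodic_def four_def ch_translate)

text \<open>Absolute summability of the coefficients permits termwise integration, and orthogonality
  of the characters leaves the single index i with \<open>enum i = p\<close>.\<close>

lemma coef_four:
  assumes a: "rapid a"
  shows "coef (four a) p = of_real area * a p"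
proof -
  let ?f = "\<lambda>n z. indicator D z *\<^sub>R (a (enum n) * ch (enum n) z * ch (- p) z)"
  have trm: "tint (\<lambda>z. a (enum n) * ch (enum n) z * ch (- p) z) = (if enum n = p then of_real area * a p else 0)" for n
    using coef_cmult[of "a (enum n)" "ch (enum n)" p] coef_ch[of "enum n" p]
    by (simp add: coef_def)
  have "coef (four a) p = (LINT z|lborel. (\<Sum>n. ?f n z))"
  proof -
    have "(\<Sum>n. ?f n z) = indicator D z *\<^sub>R (four a z * ch (- p) z)" for z
    proof -
      have "(\<Sum>n. a (enum n) * ch (enum n) z * ch (- p) z) = four a z * ch (- p) z"
        unfolding four_def by (rule suminf_mult2[symmetric, OF four_summable[OF a]])
      then show ?thesis by (simp add: indicator_def)
    qed
    then show ?thesis by (simp add: coef_def set_lebesgue_integral_def)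
  qed
  also have "\<dots> = (\<Sum>n. LINT z|lborel. ?f n z)"
  proof (rule integral_suminf)
    show "integrable lborel (?f n)" for n
      using integrable_D[OF tcontD(1), of "\<lambda>z. a (enum n) * ch (enum n) z * ch (- p) z"]
      by (simp add: set_integrable_def tcont_mult tcont_const tcont_ch)
    have "summable (\<lambda>n. norm (?f n z))" for z
      using rapid_summable_norm[OF a] by (simp add: norm_mult indicator_def)
    then show "AE z in lborel. summable (\<lambda>n. norm (?f n z))" by simp
    have "(LINT z|lborel. norm (?f n z)) = norm (a (enum n)) * area" for n
    proof -
      have "(LINT z|lborel. norm (?f n z)) = (LINT z|lborel. indicator D z *\<^sub>R norm (a (enum n)))"
        by (rule Bochner_Integration.integral_cong) (auto simp: norm_mult)
      then show ?thesis by (simp add: area_def)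
    qed
    then show "summable (\<lambda>n. LINT z|lborel. norm (?f n z))"
      using summable_mult2[OF rapid_summable_norm[OF a], of area] by simp
  qed
  also have "\<dots> = (\<Sum>n. if enum n = p then of_real area * a p else 0)"
    using trm by (simp add: set_lebesgue_integral_def)
  also have "\<dots> = of_real area * a p"
  proof -
    obtain i where i: "enum i = p" using bij_enum by (metis bij_pointE)
    then have "(enum n = p) = (n = i)" for n
      using bij_enum by (metis bij_pointE)
    then show ?thesis
      using sums_unique[OF sums_single[of i "\<lambda>_. of_real area * a p"]] by simp
  qed
  finally show ?thesis .
qed

section \<open>The symbol of \<open>dbar\<close> on characters and its lower bound\<close>

definition symb :: "int \<times> int \<Rightarrow> complex" where
  "symb p = freq p (dir 1) + \<i> * freq p (dir 2)"

lemma coef_dbar: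
  assumes "tsmooth f" "lattice_periodic w1 w2 f"
  shows "coef (dbar f) p = symb p * coef f p"
proof -
  have "coef (dbar f) p = coef (\<lambda>z. pder 1 f z + \<i> * pder 2 f z) p"
    by (simp only: dbar_def[abs_def])
  also have "\<dots> = coef (pder 1 f) p + \<i> * coef (pder 2 f) p"
  proof -
    have "tcont (pder k f)" for k
      using assms by (intro tcont_smooth tsmooth_pder periodic_pder)
    then show ?thesis
      by (subst coef_add) (auto intro!: tcont_mult tcont_const simp: coef_cmult)
  qed
  also have "\<dots> = symb p * coef f p"
    using assms by (simp add: coef_pder symb_def algebra_simps)
  finally show ?thesis .
qed

lemma dbar_four:
  assumes a: "rapid a"
  shows "dbar (four a) = four (\<lambda>p. symb p * a p)"
proof
  fix z
  have 1: "summable (\<lambda>n. (freq (enum n) v * a (enum n)) * ch (enum n) z)" for v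
    by (rule four_summable[OF rapid_freq[OF a]])
  have "dbar (four a) z = four (\<lambda>p. freq p (dir 1) * a p) z + \<i> * four (\<lambda>p. freq p (dir 2) * a p) z"
    by (simp only: dbar_def pder_four[OF a])
  also have "\<dots> = four (\<lambda>p. symb p * a p) z"
    unfolding four_def using 1
    by (subst suminf_mult[symmetric], simp, subst suminf_add) (auto simp: symb_def algebra_simps intro!: summable_mult)
  finally show "dbar (four a) z = four (\<lambda>p. symb p * a p) z" .
qed

text \<open>Up to a nonzero constant the symbol at (j,k) is the lattice vector j w2 - k w1, so
  ellipticity of \<open>dbar\<close> is the independence of the periods.\<close>

lemma symb_eq:
  "symb p = 2 * pi * (of_int (fst p) * w2 - of_int (snd p) * w1) / of_real (Im (cnj w1 * w2))"
proof -
  let ?d = "Im (cnj w1 * w2)"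
  have "complex_of_real (c1 1) + \<i> * of_real (c1 \<i>) = - \<i> * w2 / of_real ?d"
    "complex_of_real (c2 1) + \<i> * of_real (c2 \<i>) = \<i> * w1 / of_real ?d"
    using lattice unfolding c1_def c2_def
    by (simp_all add: complex_eq_iff field_simps Re_divide_of_real Im_divide_of_real del: times_complex.sel)
  moreover have "symb p = 2 * pi * \<i> * (of_int (fst p) * (of_real (c1 1) + \<i> * of_real (c1 \<i>))
      + of_int (snd p) * (of_real (c2 1) + \<i> * of_real (c2 \<i>)))"
    by (simp add: symb_def freq_def dir_def algebra_simps)
  ultimately show ?thesis
    by (simp add: algebra_simps add_divide_distrib diff_divide_distrib)
qed

text \<open>The lattice coordinates of that vector are the frequencies up to sign, hence bounded by
  its norm. The summand 1 of the height is absorbed because |j| + |k| is at least 1 for p nonzero,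
  whence the factor 2.\<close>

lemma symb_lower:
  obtains C where "C > 0" "\<And>p. p \<noteq> 0 \<Longrightarrow> height p \<le> C * norm (symb p)"
proof -
  obtain A where A: "A > 0" "\<And>v. norm (c1 v) \<le> norm v * A"
    using bounded_linear.pos_bounded[OF bounded_linear_c1] by blast
  obtain B where B: "B > 0" "\<And>v. norm (c2 v) \<le> norm v * B"
    using bounded_linear.pos_bounded[OF bounded_linear_c2] by blast
  let ?d = "\<bar>Im (cnj w1 * w2)\<bar>"
  let ?C = "2 * (A + B) * ?d / (2 * pi)"
  have d: "?d > 0" using lattice by simp
  have "height p \<le> ?C * norm (symb p)" if "p \<noteq> 0" for p
  proof -
    let ?v = "of_int (fst p) * w2 - of_int (snd p) * w1"
    have "norm (symb p) = 2 * pi * norm ?v / ?d"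
      unfolding symb_eq by (simp add: norm_mult norm_divide del: times_complex.sel)
    then have v: "norm ?v = ?d / (2 * pi) * norm (symb p)"
      using d by (simp add: field_simps del: times_complex.sel)
    have "?v = of_real (- of_int (snd p)) * w1 + of_real (of_int (fst p)) * w2"
      by simp
    then have "c1 ?v = - of_int (snd p)" "c2 ?v = of_int (fst p)"
      by (simp_all only: c1_add c2_add c1_scale c2_scale c_basis)
    then have "of_int \<bar>snd p\<bar> \<le> norm ?v * A" "of_int \<bar>fst p\<bar> \<le> norm ?v * B"
      using A(2)[of ?v] B(2)[of ?v] by simp_all
    moreover have "1 \<le> \<bar>fst p\<bar> + \<bar>snd p\<bar>"
      using that by (auto simp: prod_eq_iff)
    then have "(1::real) \<le> of_int \<bar>fst p\<bar> + of_int \<bar>snd p\<bar>"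
      by linarith
    ultimately have "height p \<le> 2 * (norm ?v * A + norm ?v * B)"
      by (simp add: height_def)
    also have "\<dots> = 2 * (A + B) * norm ?v" by (simp add: algebra_simps)
    finally show ?thesis unfolding v by (simp add: field_simps del: times_complex.sel)
  qed
  moreover have "?C > 0" using A(1) B(1) d by (simp del: times_complex.sel)
  ultimately show ?thesis using that by blast
qed

lemma symb_nonzero: "p \<noteq> 0 \<Longrightarrow> symb p \<noteq> 0"
proof
  assume "p \<noteq> 0" "symb p = 0"
  moreover obtain C where "C > 0" "\<And>p. p \<noteq> 0 \<Longrightarrow> height p \<le> C * norm (symb p)"
    by (rule symb_lower) blast
  ultimately have "height p \<le> 0" by fastforce
  then show False using height_ge_1[of p] by simp
qed

text \<open>Powers of dbar already see every frequency, so they alone give the decay.\<close>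

lemma rapid_coef:
  assumes f: "tsmooth f" "lattice_periodic w1 w2 f"
  shows "rapid (coef f)"
  unfolding rapid_def
proof
  fix N
  have it: "tsmooth ((dbar ^^ n) f) \<and> lattice_periodic w1 w2 ((dbar ^^ n) f) \<and>
      (\<forall>p. coef ((dbar ^^ n) f) p = symb p ^ n * coef f p)" for n
    by (induction n) (use f in \<open>auto simp: coef_dbar\<close>)
  obtain B where B: "\<And>z. norm ((dbar ^^ N) f z) \<le> B"
    using tcont_bounded[OF tcont_smooth, of "(dbar ^^ N) f"] it by metis
  have le: "norm (symb p) ^ N * norm (coef f p) \<le> B * area" for p
    using norm_coef_le[of "(dbar ^^ N) f" B p] tcont_smooth[of "(dbar ^^ N) f"] B it[of N]
    by (simp add: norm_mult norm_power)
  obtain C where C: "C > 0" "\<And>p. p \<noteq> 0 \<Longrightarrow> height p \<le> C * norm (symb p)"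
    by (rule symb_lower) blast
  \<comment> \<open>The symbol vanishes at p = 0 and gives no bound there; the height is 1 at that
    frequency, so the extra summand \<open>norm (coef f 0)\<close> suffices.\<close>
  have "norm (coef f p) * height p ^ N \<le> C ^ N * (B * area) + norm (coef f 0)" for p
  proof (cases "p = 0")
    case True
    have "0 \<le> B * area" using le[of 0] by (meson mult_nonneg_nonneg norm_ge_zero order_trans zero_le_power)
    then show ?thesis using True C(1) by (simp add: height_def)
  next
    case False
    have "norm (coef f p) * height p ^ N \<le> norm (coef f p) * (C * norm (symb p)) ^ N"
      using C(2)[OF False] height_ge_1[of p] by (intro mult_left_mono power_mono) auto
    also have "\<dots> = C ^ N * (norm (symb p) ^ N * norm (coef f p))"
      by (simp add: power_mult_distrib)
    also have "\<dots> \<le> C ^ N * (B * area)"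
      using C(1) le by (intro mult_left_mono) auto
    finally show ?thesis by (simp add: add_increasing2)
  qed
  then show "\<exists>M. \<forall>p. norm (coef f p) * height p ^ N \<le> M" by blast
qed

text \<open>Dividing the coefficients by the symbol solves the equation formally; the lower bound
  for the symbol preserves rapid decay, so the series is smooth, and \<open>coef_unique\<close>
  recognizes its image under \<open>dbar\<close> as h.\<close>

theorem dbar_solvable:
  assumes h: "tsmooth h" "lattice_periodic w1 w2 h" and mean: "tint h = 0"
  obtains f where "tsmooth f" "lattice_periodic w1 w2 f" "dbar f = h"
proof -
  obtain C where C: "C > 0" "\<And>p. p \<noteq> 0 \<Longrightarrow> height p \<le> C * norm (symb p)"
    by (rule symb_lower) blast
  \<comment> \<open>The value 0 at the zero frequency is consistent because the mean of h vanishes;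
    \<open>area\<close> converts the unnormalized coefficients into those of the series.\<close>
  define g where "g p = (if p = 0 then 0 else 1 / (of_real area * symb p))" for p
  define a where "a p = g p * coef h p" for p
  have "norm (g p) \<le> (C / area) * height p" for p
  proof (cases "p = 0")
    case False
    have s: "norm (symb p) > 0" using symb_nonzero[OF False] by simp
    have "1 \<le> C * norm (symb p) * 1" using C(2)[OF False] height_ge_1[of p] by linarith
    also have "\<dots> \<le> C * norm (symb p) * height p"
      using C(1) height_ge_1 by (intro mult_left_mono) auto
    finally show ?thesis using False s area_pos by (simp add: g_def norm_divide norm_mult field_simps)
  qed (use C(1) area_pos in \<open>simp add: g_def height_def\<close>)
  then have a: "rapid a"
    unfolding a_def[abs_def] by (rule rapid_mult[OF rapid_coef[OF h]])
  have "coef h 0 = 0" using mean by (simp add: coef_def)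
  then have "symb p * a p = coef h p / area" for p
    using symb_nonzero[of p] by (simp add: a_def g_def)
  then have "dbar (four a) = four (\<lambda>p. coef h p / area)"
    by (simp add: dbar_four[OF a])
  also have "\<dots> = h"
  proof (rule coef_unique)
    have r: "rapid (\<lambda>p. coef h p / area)"
    proof -
      have "norm (1 / complex_of_real area) \<le> (1 / area) * height p" for p
        using area_pos height_ge_1[of p] by (simp add: norm_divide divide_right_mono)
      from rapid_mult[OF rapid_coef[OF h] this] show ?thesis by simp
    qed
    show "tcont (four (\<lambda>p. coef h p / area))"
      by (intro tcont_smooth tsmooth_four periodic_four r)
    show "tcont h" by (intro tcont_smooth h)
    show "coef (four (\<lambda>p. coef h p / area)) p = coef h p" for p
      using area_pos by (simp add: coef_four[OF r])
  qed
  finally show ?thesis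
    by (rule that[OF tsmooth_four[OF a] periodic_four])
qed

text \<open>A nonzero symbol forces every coefficient except the one at frequency 0 to vanish, so f
  has the coefficients of its mean value.\<close>

theorem dbar_kernel:
  assumes f: "tsmooth f" "lattice_periodic w1 w2 f" and zero: "dbar f = (\<lambda>z. 0)"
  obtains c where "f = (\<lambda>z. c)"
proof
  show "f = (\<lambda>z. coef f 0 / area)"
  proof (rule coef_unique)
    fix p
    have "coef (\<lambda>z. coef f 0 / area) p = coef f 0 / area * coef (ch 0) p"
      using coef_cmult[of "coef f 0 / area" "ch 0" p] by simp
    also have "\<dots> = (if p = 0 then coef f 0 else 0)"
      using area_pos by (simp add: coef_ch)
    also have "\<dots> = coef f p"
      using coef_dbar[OF f, of p] symb_nonzero[of p] by (auto simp: zero coef_def)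
    finally show "coef f p = coef (\<lambda>z. coef f 0 / area) p" by simp
  qed (auto intro: tcont_smooth tcont_const f)
qed

lemma tint_cnj: "tint (\<lambda>z. cnj (f z)) = cnj (tint f)"
proof -
  have "tint (\<lambda>z. cnj (f z)) = (LINT z|lborel. cnj (indicator D z *\<^sub>R f z))"
    by (simp add: set_lebesgue_integral_def)
  also have "\<dots> = cnj (tint f)"
    unfolding set_lebesgue_integral_def by (rule Bochner_Integration.integral_cnj)
  finally show ?thesis .
qed

lemma periodic_cnj: "lattice_periodic w1 w2 f \<Longrightarrow> lattice_periodic w1 w2 (\<lambda>z. cnj (f z))"
  by (simp add: lattice_periodic_def)

corollary del_solvable:
  assumes h: "tsmooth h" "lattice_periodic w1 w2 h" and mean: "tint h = 0"
  obtains f where "tsmooth f" "lattice_periodic w1 w2 f" "del f = h"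
proof -
  obtain g where g: "tsmooth g" "lattice_periodic w1 w2 g" "dbar g = (\<lambda>z. cnj (h z))"
    by (rule dbar_solvable[of "\<lambda>z. cnj (h z)"]) (use assms in \<open>auto simp: tint_cnj intro: periodic_cnj\<close>)
  show ?thesis
    using g by (intro that[of "\<lambda>z. cnj (g z)"]) (auto simp: del_cnj periodic_cnj)
qed

corollary del_kernel:
  assumes f: "tsmooth f" "lattice_periodic w1 w2 f" and zero: "del f = (\<lambda>z. 0)"
  obtains c where "f = (\<lambda>z. c)"
proof -
  obtain c where "(\<lambda>z. cnj (f z)) = (\<lambda>z. c)"
    by (rule dbar_kernel[of "\<lambda>z. cnj (f z)"]) (use assms in \<open>auto simp: dbar_cnj intro: periodic_cnj\<close>)
  then have "f = (\<lambda>z. cnj c)" by (metis complex_cnj_cnj)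
  then show ?thesis by (rule that)
qed

lemma tint_dbar:
  assumes f: "tsmooth f" "lattice_periodic w1 w2 f"
  shows "tint (dbar f) = 0"
  using coef_dbar[OF f, of 0] by (simp add: coef_def symb_def freq_def)

lemma tint_del:
  assumes f: "tsmooth f" "lattice_periodic w1 w2 f"
  shows "tint (del f) = 0"
proof -
  have "tint (\<lambda>z. cnj (del f z)) = 0"
    using tint_dbar[of "\<lambda>z. cnj (f z)"] f by (auto simp: dbar_cnj[OF f(1)] intro: periodic_cnj)
  then show ?thesis by (simp add: tint_cnj)
qed

end

section \<open>Trace free symmetric tensors\<close>

lemma idx_Nil [simp]: "[] \<in> idx r \<longleftrightarrow> r = 0"
  by (auto simp: idx_def)

lemma idx_Cons [simp]: "k # is \<in> idx (Suc r) \<longleftrightarrow> k \<in> {1,2} \<and> is \<in> idx r"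
  by (auto simp: idx_def)

lemma idx_snoc [simp]: "is @ [k] \<in> idx (Suc r) \<longleftrightarrow> k \<in> {1,2} \<and> is \<in> idx r"
  by (auto simp: idx_def)

lemma finite_idx: "finite (idx r)"
  using finite_lists_length_eq[of "{1,2::nat}" r] by (simp add: idx_def conj_commute)

lemma card_idx: "card (idx r) = 2 ^ r"
  using card_lists_length_eq[of "{1,2::nat}" r] by (simp add: idx_def conj_commute numeral_2_eq_2)

lemma idx_mset: "is \<in> idx r \<Longrightarrow> mset js = mset is \<Longrightarrow> js \<in> idx r"
  by (auto simp: idx_def dest: mset_eq_setD mset_eq_length)

lemma idx_update: "is \<in> idx r \<Longrightarrow> p \<in> {1,2} \<Longrightarrow> is[a := p] \<in> idx r"
  using set_update_subset_insert[of "is" a p] by (auto simp: idx_def)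

lemma sum_idx_Cons:
  "(\<Sum>is\<in>idx (Suc r). f is) = (\<Sum>k\<in>{1,2}. \<Sum>is\<in>idx r. f (k # is))"
proof -
  have "idx (Suc r) = (\<lambda>(k,is). k # is) ` ({1,2} \<times> idx r)"
  proof (intro equalityI subsetI)
    fix js assume "js \<in> idx (Suc r)"
    then show "js \<in> (\<lambda>(k,is). k # is) ` ({1,2} \<times> idx r)"
      by (cases js) (auto simp: image_iff idx_def)
  qed auto
  moreover have "inj_on (\<lambda>(k,is). k # is) ({1,2} \<times> idx r)"
    by (auto simp: inj_on_def)
  ultimately show ?thesis
    unfolding sum.cartesian_product by (simp only: sum.reindex o_def) (intro sum.cong; auto)
qed

text \<open>The last index is split off because \<open>nabla\<close> puts the index of
  differentiation last.\<close>

lemma sum_idx_snoc: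
  "(\<Sum>is\<in>idx (Suc r). f is) = (\<Sum>is\<in>idx r. \<Sum>k\<in>{1,2}. f (is @ [k]))"
proof -
  have "idx (Suc r) = (\<lambda>(is,k). is @ [k]) ` (idx r \<times> {1,2})"
  proof (intro equalityI subsetI)
    fix js assume "js \<in> idx (Suc r)"
    then show "js \<in> (\<lambda>(is,k). is @ [k]) ` (idx r \<times> {1,2})"
      by (cases js rule: rev_cases) (auto simp: image_iff idx_def)
  qed auto
  moreover have "inj_on (\<lambda>(is,k). is @ [k]) (idx r \<times> {1,2})"
    by (auto simp: inj_on_def)
  ultimately show ?thesis
    unfolding sum.cartesian_product by (simp only: sum.reindex o_def) (intro sum.cong; auto)
qed

text \<open>The components of \<open>dz\<^sup>r\<close>: since \<open>dz = dx + \<i> dy\<close>, every index 2 contributes a factor \<open>\<i>\<close>.\<close>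

definition dz :: "nat list \<Rightarrow> complex" where
  "dz is = prod_list (map dir is)"

lemma dir_simps [simp]: "dir 1 = 1" "dir (Suc 0) = 1" "dir 2 = \<i>"
  by (simp_all add: dir_def)

lemma dir_unit [simp]: "dir k * cnj (dir k) = 1" "cnj (dir k) * dir k = 1"
  by (simp_all add: dir_def)

lemma dz_simps [simp]: "dz [] = 1" "dz (k # is) = dir k * dz is" "dz (is @ js) = dz is * dz js"
  by (simp_all add: dz_def)

lemma dz_mset: "mset js = mset is \<Longrightarrow> dz js = dz is"
  unfolding dz_def by (metis mset_map prod_mset_prod_list)

lemma dz_replicate [simp]: "dz (replicate n 1) = 1" "dz (replicate n (Suc 0)) = 1"
  by (induction n) auto

lemma dz_unit [simp]: "dz is * cnj (dz is) = 1"
proof (induction "is")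
  case (Cons k ks)
  have "dz (k # ks) * cnj (dz (k # ks)) = (dir k * cnj (dir k)) * (dz ks * cnj (dz ks))"
    by (simp only: dz_simps complex_cnj_mult mult_ac)
  with Cons show ?case by simp
qed simp

text \<open>The values of \<open>dir\<close> have modulus 1, so the conjugate cancels the factor of
  the replaced index.\<close>

lemma dz_update:
  assumes "a < length is"
  shows "dz (is[a := p]) = dz is * cnj (dir (is ! a)) * dir p"
proof -
  have "dz is = dz (take a is) * (dir (is ! a) * dz (drop (Suc a) is))"
    using arg_cong[OF id_take_nth_drop[OF assms], of dz] by simp
  moreover have "dz (is[a := p]) = dz (take a is) * (dir p * dz (drop (Suc a) is))"
    using arg_cong[OF upd_conv_take_nth_drop[OF assms], of dz] by simp
  ultimately have "dz is * cnj (dir (is ! a)) * dir p =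
      dz (is[a := p]) * (dir (is ! a) * cnj (dir (is ! a)))"
    by (simp only: mult_ac)
  then show ?thesis by simp
qed

text \<open>Splitting off the first index leaves the factor 1 + i^2 = 0. This isotropy makes
  \<open>dz\<close> and its conjugate orthogonal for the hermitian product.\<close>

lemma sum_dz_dz:
  assumes "r \<ge> 1" shows "(\<Sum>is\<in>idx r. dz is * dz is) = 0"
proof -
  from assms obtain r' where r: "r = Suc r'" by (cases r) auto
  have "(\<Sum>is\<in>idx r'. dir k * dz is * (dir k * dz is)) = dir k * dir k * (\<Sum>is\<in>idx r'. dz is * dz is)" for k
    by (simp add: sum_distrib_left mult_ac)
  then show ?thesis by (simp add: r sum_idx_Cons)
qed

lemma sum_cnj_dz_dz:
  assumes "r \<ge> 1" shows "(\<Sum>is\<in>idx r. cnj (dz is) * cnj (dz is)) = 0"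
  using arg_cong[OF sum_dz_dz[OF assms], of cnj] by (simp add: cnj_sum)

text \<open>The tensor \<open>u dz\<^sup>r + v dw\<^sup>r\<close>, with w the conjugate of z.\<close>

definition tens :: "nat \<Rightarrow> complex \<Rightarrow> complex \<Rightarrow> nat list \<Rightarrow> complex" where
  "tens r u v is = (if is \<in> idx r then dz is * u + cnj (dz is) * v else 0)"

text \<open>Isotropy removes the v part, and each of the 2^r components contributes u; together with
  \<open>sum_tens_dz\<close> this recovers both coefficients of a tensor.\<close>

lemma sum_tens_cnj_dz:
  assumes "r \<ge> 1" shows "(\<Sum>is\<in>idx r. tens r u v is * cnj (dz is)) = 2 ^ r * u"
proof -
  have "(\<Sum>is\<in>idx r. tens r u v is * cnj (dz is)) =
      (\<Sum>is\<in>idx r. u * (dz is * cnj (dz is)) + v * (cnj (dz is) * cnj (dz is)))"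
    by (intro sum.cong) (auto simp: tens_def algebra_simps simp del: dz_unit)
  also have "\<dots> = u * (\<Sum>is\<in>idx r. 1) + v * (\<Sum>is\<in>idx r. cnj (dz is) * cnj (dz is))"
    by (simp add: sum.distrib sum_distrib_left)
  finally show ?thesis using assms by (simp add: sum_cnj_dz_dz card_idx)
qed

lemma sum_tens_dz:
  assumes "r \<ge> 1" shows "(\<Sum>is\<in>idx r. tens r u v is * dz is) = 2 ^ r * v"
proof -
  have "(\<Sum>is\<in>idx r. tens r u v is * dz is) =
      (\<Sum>is\<in>idx r. cnj (tens r (cnj v) (cnj u) is * cnj (dz is)))"
    by (intro sum.cong) (auto simp: tens_def algebra_simps)
  also have "\<dots> = cnj (2 ^ r * cnj v)"
    by (simp only: cnj_sum[symmetric] sum_tens_cnj_dz[OF assms])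
  finally show ?thesis by simp
qed

lemma tens_11: "r \<ge> 1 \<Longrightarrow> tens r u v (replicate r 1) = u + v"
  by (auto simp: tens_def idx_def)

lemma tens_12: "r \<ge> 1 \<Longrightarrow> tens r u v (replicate (r - 1) 1 @ [2]) = \<i> * (u - v)"
  by (auto simp: tens_def idx_def algebra_simps)

text \<open>The two pairings read off u and v. In rank 0 only the sum u + v would be
  visible.\<close>

lemma tens_inject:
  assumes "r \<ge> 1" "\<And>is. tens r u v is = tens r u' v' is"
  shows "u = u' \<and> v = v'"
proof -
  have "tens r u v = tens r u' v'" using assms(2) by (rule ext)
  then show ?thesis
    using sum_tens_cnj_dz[OF assms(1), of u v] sum_tens_cnj_dz[OF assms(1), of u' v']
      sum_tens_dz[OF assms(1), of u v] sum_tens_dz[OF assms(1), of u' v'] by simp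
qed

lemma trace_pt_eq: "trace_pt mu z h is = of_real (exp (- 2 * mu z)) * (h (1 # 1 # is) + h (2 # 2 # is))"
  by (simp add: trace_pt_def ginv_def algebra_simps)

lemma tens_kerj: "tens r u v \<in> kerj_pt mu r z"
proof -
  have "tens r u v \<in> symt r"
  proof -
    have "tens r u v js = tens r u v is" if "is \<in> idx r" "mset js = mset is" for "is" js
      using that(1) idx_mset[OF that] dz_mset[OF that(2)] by (simp add: tens_def)
    then show ?thesis unfolding symt_def by (simp add: tens_def)
  qed
  moreover have "trace_pt mu z (tens r u v) is = 0" if "is \<in> idx (r - 2)" for "is"
  proof (cases "r \<ge> 2")
    case True
    then obtain s where "r = Suc (Suc s)" by (metis add_2_eq_Suc le_Suc_ex)
    with that show ?thesis by (simp add: trace_pt_eq tens_def)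
  next
    case False
    \<comment> \<open>For r < 2 the truncated subtraction gives \<open>r - 2 = 0\<close>; lists of
      length 2 then lie outside \<open>idx r\<close>, where the default value 0 makes the trace
      vanish.\<close>
    then have "1 # 1 # is \<notin> idx r" "2 # 2 # is \<notin> idx r" by (auto simp: idx_def)
    then show ?thesis by (simp add: trace_pt_eq tens_def)
  qed
  ultimately show ?thesis by (simp add: kerj_pt_def)
qed

lemma all_ones: "is \<in> idx r \<Longrightarrow> 2 \<notin> set is \<Longrightarrow> is = replicate r 1"
  by (rule replicate_eqI) (auto simp: idx_def)

text \<open>Induction on the number of indices 2: symmetry brings two of them to the front and the
  trace condition trades them for two indices 1 with a minus sign, the same rule that
  \<open>dz\<close> and its conjugate obey because i^2 = -1. The coefficients solve the base cases u
  + v = h_{1...1} and i (u - v) = h_{1...12}.\<close>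

lemma kerj_tens:
  assumes h: "h \<in> kerj_pt mu r z"
  shows "h = tens r ((h (replicate r 1) - \<i> * h (replicate (r - 1) 1 @ [2])) / 2)
      ((h (replicate r 1) + \<i> * h (replicate (r - 1) 1 @ [2])) / 2)" (is "h = tens r ?u ?v")
proof
  have sym: "h js = h is" if "is \<in> idx r" "mset js = mset is" for "is" js
    using h that unfolding kerj_pt_def symt_def by blast
  have out: "h is = 0" if "is \<notin> idx r" for "is"
    using h that by (auto simp: kerj_pt_def symt_def)
  have "h is = dz is * ?u + cnj (dz is) * ?v" if "is \<in> idx r" for "is"
    using that
  proof (induction "count (mset is) 2" arbitrary: "is" rule: less_induct)
    case less
    show ?case
    proof (cases "2 \<in> set is")
      case False
      with less.prems have "is = replicate r 1" by (intro all_ones)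
      then show ?thesis by (simp add: field_simps)
    next
      case two: True
      then have perm: "mset (2 # remove1 2 is) = mset is" by simp
      with less.prems have "2 # remove1 2 is \<in> idx r" by (rule idx_mset)
      then obtain s where s: "r = Suc s" and rest: "remove1 2 is \<in> idx s"
        by (cases r) (auto simp: idx_def)
      show ?thesis
      proof (cases "2 \<in> set (remove1 2 is)")
        case False
        with rest have "remove1 2 is = replicate s 1" by (intro all_ones)
        with perm have m: "mset (replicate s 1 @ [2]) = mset is" by simp
        with less.prems have "h is = h (replicate s 1 @ [2])" by (metis sym)
        moreover have "dz is = \<i>" using dz_mset[OF m] by simp
        ultimately show ?thesis using s by (simp add: field_simps)
      next
        case True
        define js where "js = remove1 2 (remove1 2 is)"
        have m: "mset (2 # 2 # js) = mset is"
        proof -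
          have "mset (2 # remove1 2 ys) = mset ys" if "2 \<in> set ys" for ys :: "nat list"
            using that by simp
          from this[OF True] have "mset (2 # js) = mset (remove1 2 is)"
            by (simp only: js_def)
          then show ?thesis using perm by (simp only: mset.simps)
        qed
        with less.prems have 22: "2 # 2 # js \<in> idx r" by (rule idx_mset)
        then obtain t where t: "s = Suc t" "js \<in> idx t"
          unfolding s by (cases s) (auto simp: idx_def)
        have 11: "1 # 1 # js \<in> idx r" using s t by simp
        have "trace_pt mu z h js = 0"
          using h t s by (simp add: kerj_pt_def)
        then have tr: "h (2 # 2 # js) = - h (1 # 1 # js)"
          by (simp add: trace_pt_eq eq_neg_iff_add_eq_0 add.commute)
        have "count (mset (1 # 1 # js)) 2 < count (mset is) 2"
          unfolding m[symmetric] by simp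
        from less.hyps[OF this 11]
        have "h (1 # 1 # js) = dz js * ?u + cnj (dz js) * ?v" by simp
        moreover have "h is = h (2 # 2 # js)"
          by (rule sym[OF 22 m[symmetric]])
        moreover have "dz is = - dz js"
          using dz_mset[OF m] by simp
        ultimately show ?thesis using tr by simp
      qed
    qed
  qed
  then show "h is = tens r ?u ?v is" for "is"
    using out by (simp add: tens_def)
qed

section \<open>Orthogonal projection onto the trace free tensors\<close>

lemma tinner_eq:
  "tinner mu r z u v = of_real (exp (- 2 * mu z) ^ r) * (\<Sum>is\<in>idx r. u is * cnj (v is))"
proof -
  have "(\<Prod>a<r. ginv mu (is ! a) (js ! a) z) = (if js = is then exp (- 2 * mu z) ^ r else 0)"
    if idx: "is \<in> idx r" "js \<in> idx r" for "is" js
  proof (cases "js = is")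
    case False
    then obtain a where "a < r" "is ! a \<noteq> js ! a"
      using idx nth_equalityI[of "is" js] by (auto simp: idx_def)
    then have "(\<Prod>a<r. ginv mu (is ! a) (js ! a) z) = 0"
      by (intro prod_zero) (auto simp: ginv_def)
    with False show ?thesis by simp
  qed (simp add: ginv_def)
  then have "tinner mu r z u v = (\<Sum>is\<in>idx r. \<Sum>js\<in>idx r.
      if js = is then of_real (exp (- 2 * mu z) ^ r) * u is * cnj (v js) else 0)"
    unfolding tinner_def by (intro sum.cong) auto
  also have "\<dots> = (\<Sum>is\<in>idx r. of_real (exp (- 2 * mu z) ^ r) * u is * cnj (v is))"
    by (simp add: finite_idx)
  finally show ?thesis by (simp add: sum_distrib_left mult.assoc)
qed

text \<open>The trace free tensors are spanned by two orthogonal vectors whose squared norm is 2^r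
  up to a conformal factor that cancels. Testing against these two alone determines both
  coefficients, which gives uniqueness in the definite description.\<close>

lemma proj_pt_eq:
  assumes r: "r \<ge> 1"
  shows "proj_pt mu r z h =
    tens r ((\<Sum>is\<in>idx r. h is * cnj (dz is)) / 2 ^ r) ((\<Sum>is\<in>idx r. h is * dz is) / 2 ^ r)"
    (is "_ = tens r ?a ?b")
proof -
  have inner: "tinner mu r z (\<lambda>is. h is - tens r a b is) (tens r c d) =
      of_real (exp (- 2 * mu z) ^ r) * (cnj c * ((\<Sum>is\<in>idx r. h is * cnj (dz is)) - 2 ^ r * a)
        + cnj d * ((\<Sum>is\<in>idx r. h is * dz is) - 2 ^ r * b))" for a b c d
  proof -
    have "(\<Sum>is\<in>idx r. (h is - tens r a b is) * cnj (tens r c d is)) =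
       (\<Sum>is\<in>idx r. cnj c * (h is * cnj (dz is) - tens r a b is * cnj (dz is))
          + cnj d * (h is * dz is - tens r a b is * dz is))"
      by (intro sum.cong) (auto simp: tens_def[of r c d] algebra_simps)
    also have "\<dots> = cnj c * ((\<Sum>is\<in>idx r. h is * cnj (dz is)) - 2 ^ r * a)
        + cnj d * ((\<Sum>is\<in>idx r. h is * dz is) - 2 ^ r * b)"
      by (simp only: sum.distrib sum_subtractf sum_distrib_left[symmetric] sum_tens_cnj_dz[OF r] sum_tens_dz[OF r])
    finally show ?thesis by (simp add: tinner_eq)
  qed
  show ?thesis
    unfolding proj_pt_def
  proof (rule the_equality, intro conjI ballI tens_kerj)
    fix v assume "v \<in> kerj_pt mu r z"
    then obtain c d where "v = tens r c d" using kerj_tens by blast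
    then show "tinner mu r z (\<lambda>is. h is - tens r ?a ?b is) v = 0"
      by (simp add: inner)
  next
    fix h' assume h': "h' \<in> kerj_pt mu r z \<and> (\<forall>v\<in>kerj_pt mu r z. tinner mu r z (\<lambda>is. h is - h' is) v = 0)"
    then obtain a b where ab: "h' = tens r a b" using kerj_tens by blast
    have "tinner mu r z (\<lambda>is. h is - tens r a b is) (tens r c d) = 0" for c d
      using h' ab tens_kerj by blast
    from this[of 1 0] this[of 0 1] show "h' = tens r ?a ?b"
      by (simp add: ab inner)
  qed
qed

text \<open>Symmetrization is invisible to symmetric test tensors, so it can be dropped before projecting.\<close>

lemma sum_symz:
  assumes E: "\<And>is js. mset js = mset is \<Longrightarrow> E js = E is"
  shows "(\<Sum>js\<in>idx r. symz r h js * E js) = (\<Sum>js\<in>idx r. h js * E js)"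
proof -
  let ?P = "{\<pi>. \<pi> permutes {..<r}}"
  have one: "(\<Sum>js\<in>idx r. h (permute_list \<pi> js) * E js) = (\<Sum>js\<in>idx r. h js * E js)"
    if \<pi>: "\<pi> permutes {..<r}" for \<pi>
  proof (rule sum.reindex_bij_witness[where i = "permute_list (inv \<pi>)" and j = "permute_list \<pi>"])
    fix js assume js: "js \<in> idx r"
    then have len: "length js = r" by (simp add: idx_def)
    have inv: "inv \<pi> permutes {..<r}" using \<pi> by (rule permutes_inv)
    have p: "\<pi> permutes {..<length js}" "inv \<pi> permutes {..<length js}" using \<pi> inv len by auto
    show "permute_list \<pi> js \<in> idx r" "permute_list (inv \<pi>) js \<in> idx r"
      using js p by (auto intro: idx_mset)
    show "permute_list (inv \<pi>) (permute_list \<pi> js) = js"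
      using permute_list_compose[OF p(2), of \<pi>] permutes_inv_o(1)[OF \<pi>] by simp
    show "permute_list \<pi> (permute_list (inv \<pi>) js) = js"
      using permute_list_compose[OF p(1), of "inv \<pi>"] permutes_inv_o(2)[OF \<pi>] by simp
    show "h (permute_list \<pi> js) * E (permute_list \<pi> js) = h (permute_list \<pi> js) * E js"
      using E[of "permute_list \<pi> js" js] p by simp
  qed
  have "(\<Sum>js\<in>idx r. symz r h js * E js) =
      (\<Sum>js\<in>idx r. \<Sum>\<pi>\<in>?P. 1 / of_nat (fact r) * (h (permute_list \<pi> js) * E js))"
  proof (rule sum.cong)
    fix js assume js: "js \<in> idx r"
    then have "length js = r" by (simp add: idx_def)
    then have "symz r h js = 1 / of_nat (fact r) * (\<Sum>\<pi>\<in>?P. h (permute_list \<pi> js))"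
      using js by (simp add: symz_def permute_list_def)
    then show "symz r h js * E js = (\<Sum>\<pi>\<in>?P. 1 / of_nat (fact r) * (h (permute_list \<pi> js) * E js))"
      by (simp only: sum_distrib_left sum_distrib_right mult.assoc)
  qed simp
  also have "\<dots> = (\<Sum>\<pi>\<in>?P. 1 / of_nat (fact r) * (\<Sum>js\<in>idx r. h (permute_list \<pi> js) * E js))"
    by (subst sum.swap) (simp only: sum_distrib_left)
  also have "\<dots> = (\<Sum>\<pi>\<in>?P. 1 / of_nat (fact r) * (\<Sum>js\<in>idx r. h js * E js))"
    by (intro sum.cong) (auto simp: one)
  also have "\<dots> = (\<Sum>js\<in>idx r. h js * E js)"
    by (simp add: card_permutations[of "{..<r}" r])
  finally show ?thesis .
qed

lemma proj_symz:
  assumes "r \<ge> 1"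
  shows "proj_pt mu r z (symz r h) =
    tens r ((\<Sum>is\<in>idx r. h is * cnj (dz is)) / 2 ^ r) ((\<Sum>is\<in>idx r. h is * dz is) / 2 ^ r)"
proof -
  have "(\<Sum>is\<in>idx r. symz r h is * dz is) = (\<Sum>is\<in>idx r. h is * dz is)"
    by (rule sum_symz) (rule dz_mset)
  moreover have "(\<Sum>is\<in>idx r. symz r h is * cnj (dz is)) = (\<Sum>is\<in>idx r. h is * cnj (dz is))"
    by (rule sum_symz) (rule arg_cong[where f = cnj, OF dz_mset])
  ultimately show ?thesis by (simp only: proj_pt_eq[OF assms])
qed

section \<open>The Levi-Civita connection in complex form\<close>

lemma chr_eq:
  assumes mu: "\<And>z. mu differentiable (at z)" and p: "p \<in> {1,2}"
  shows "chr mu p k i z = (if i = p then pder k mu z else 0) + (if k = p then pder i mu z else 0)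
    - (if k = i then pder p mu z else 0)"
proof -
  have g: "pder a (gmet mu b c) z = (if b = c then exp (2 * mu z) * (2 * pder a mu z) else 0)" for a b c
  proof (cases "b = c")
    case True
    have d: "(\<lambda>z. 2 * mu z) differentiable (at z)"
      by (intro differentiable_mult differentiable_const mu)
    have "gmet mu b c = (\<lambda>z. exp (2 * mu z))" using True by (simp add: gmet_def fun_eq_iff)
    moreover have "pder a (\<lambda>z. 2 * mu z) z = 2 * pder a mu z"
      by (rule pder_bounded_linear[OF bounded_linear_mult_right mu])
    ultimately show ?thesis using True pder_exp[OF d] by simp
  next
    case False
    then have "gmet mu b c = (\<lambda>z. 0)" by (simp add: gmet_def fun_eq_iff)
    with False show ?thesis by simp
  qed
  have e: "exp (- 2 * mu z) * exp (2 * mu z) = 1"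
    by (simp flip: exp_add)
  have "chr mu p k i z = 1/2 * (exp (- 2 * mu z) *
      (pder k (gmet mu i p) z + pder i (gmet mu k p) z - pder p (gmet mu k i) z))"
    unfolding chr_def ginv_def using p by auto
  also have "\<dots> = (exp (- 2 * mu z) * exp (2 * mu z)) *
      ((if i = p then pder k mu z else 0) + (if k = p then pder i mu z else 0) - (if k = i then pder p mu z else 0))"
    by (auto simp: g algebra_simps)
  finally show ?thesis by (simp only: e mult_1_left)
qed

text \<open>This is \<open>del\<close> of mu, written out because mu is real-valued; in complex
  coordinates it is the Christoffel symbol with all three indices z.\<close>

definition mu_z :: "(complex \<Rightarrow> real) \<Rightarrow> complex \<Rightarrow> complex" where
  "mu_z mu z = of_real (pder 1 mu z) - \<i> * of_real (pder 2 mu z)"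

text \<open>Contraction with dz leaves no mixed terms: the connection respects the splitting into dz
  and its conjugate, the reason why u and v never interact.\<close>

lemma chr_dir:
  assumes "\<And>z. mu differentiable (at z)" and "k \<in> {1,2}" "i \<in> {1,2}"
  shows "(\<Sum>p\<in>{1,2}. of_real (chr mu p k i z) * dir p) = mu_z mu z * dir k * dir i"
proof -
  have s: "(\<Sum>p\<in>{1,2}. of_real (chr mu p k i z) * dir p) =
      of_real (chr mu 1 k i z) + \<i> * of_real (chr mu 2 k i z)"
    by (simp add: mult.commute)
  show ?thesis
    unfolding s using assms(2,3) by (auto simp: chr_eq[OF assms(1)] mu_z_def algebra_simps)
qed

text \<open>By \<open>chr_dir\<close> each of the r indices contributes the same connection term.
  The Christoffel symbols are real, so the v part is the conjugate computation.\<close>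

lemma cov_tens:
  assumes mu: "\<And>z. mu differentiable (at z)"
    and u: "u differentiable (at z)" and v: "v differentiable (at z)"
    and "is": "is \<in> idx r" and k: "k \<in> {1,2}"
  shows "cov mu (\<lambda>is z. tens r (u z) (v z) is) is k z =
    tens r (pder k u z - of_nat r * mu_z mu z * dir k * u z)
      (pder k v z - of_nat r * cnj (mu_z mu z) * cnj (dir k) * v z) is"
proof -
  have len: "length is = r" and set: "\<And>a. a < r \<Longrightarrow> is ! a \<in> {1,2}"
    using "is" nth_mem[of _ "is"] unfolding idx_def by blast+
  have deriv: "pder k (\<lambda>z. tens r (u z) (v z) is) z = dz is * pder k u z + cnj (dz is) * pder k v z"
    using "is" u v by (simp add: tens_def pder_add pder_cmult)
  have conn: "(\<Sum>p\<in>{1,2}. of_real (chr mu p k (is ! a) z) * tens r (u z) (v z) (is[a := p])) =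
      dz is * (mu_z mu z * dir k * u z) + cnj (dz is) * (cnj (mu_z mu z) * cnj (dir k) * v z)" if "a < r" for a
  proof -
    let ?i = "is ! a" and ?c = "\<lambda>p. complex_of_real (chr mu p k (is ! a) z)"
    have "?c p * tens r (u z) (v z) (is[a := p]) =
        dz is * cnj (dir ?i) * u z * (?c p * dir p) + cnj (dz is * cnj (dir ?i)) * v z * cnj (?c p * dir p)"
      if "p \<in> {1,2}" for p
      using idx_update[OF "is" that, of a] dz_update[of a "is" p] \<open>a < r\<close> len
      by (simp add: tens_def algebra_simps)
    then have "(\<Sum>p\<in>{1,2}. ?c p * tens r (u z) (v z) (is[a := p])) =
        (\<Sum>p\<in>{1,2}. dz is * cnj (dir ?i) * u z * (?c p * dir p) + cnj (dz is * cnj (dir ?i)) * v z * cnj (?c p * dir p))"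
      by (intro sum.cong) auto
    also have "\<dots> = dz is * cnj (dir ?i) * u z * (\<Sum>p\<in>{1,2}. ?c p * dir p)
        + cnj (dz is * cnj (dir ?i)) * v z * cnj (\<Sum>p\<in>{1,2}. ?c p * dir p)"
      by (simp only: sum.distrib sum_distrib_left cnj_sum)
    also have "\<dots> = (dir ?i * cnj (dir ?i)) * (dz is * (mu_z mu z * dir k * u z))
        + (dir ?i * cnj (dir ?i)) * (cnj (dz is) * (cnj (mu_z mu z) * cnj (dir k) * v z))"
      unfolding chr_dir[OF mu k set[OF that]] by (simp only: complex_cnj_mult complex_cnj_cnj mult_ac)
    finally show ?thesis by simp
  qed
  have "(\<Sum>a<length is. \<Sum>p\<in>{1,2}. of_real (chr mu p k (is ! a) z) * tens r (u z) (v z) (is[a := p])) =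
      of_nat r * (dz is * (mu_z mu z * dir k * u z) + cnj (dz is) * (cnj (mu_z mu z) * cnj (dir k) * v z))"
    unfolding len by (subst sum.cong[OF refl conn]) auto
  then show ?thesis
    unfolding cov_def deriv using "is" by (simp add: tens_def algebra_simps)
qed

text \<open>By \<open>proj_symz\<close> only two pairings count. The one for u contracts the
  derivative index with \<open>cnj (dir k)\<close>: the partials combine to \<open>del u\<close>,
  and the connection term doubles since \<open>dir k * cnj (dir k)\<close> sums to 2. The factor 1/2
  is 2^m divided by 2^(m+1).\<close>

lemma proj_dsym:
  assumes m: "m \<ge> 1" and mu: "\<And>z. mu differentiable (at z)"
    and u: "\<And>z. u differentiable (at z)" and v: "\<And>z. v differentiable (at z)"
  shows "proj_field mu (m + 1) (dsym mu m (\<lambda>is z. tens m (u z) (v z) is)) =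
    (\<lambda>is z. tens (m + 1) (1/2 * (del u z - 2 * of_nat m * mu_z mu z * u z))
      (1/2 * (dbar v z - 2 * of_nat m * cnj (mu_z mu z) * v z)) is)"
proof (intro ext)
  fix "is" z
  let ?F = "\<lambda>is z. tens m (u z) (v z) is"
  let ?X = "\<lambda>k. pder k u z - of_nat m * mu_z mu z * dir k * u z"
  let ?Y = "\<lambda>k. pder k v z - of_nat m * cnj (mu_z mu z) * cnj (dir k) * v z"
  have nab: "nabla mu m ?F (js @ [k]) z = tens m (?X k) (?Y k) js" if "js \<in> idx m" "k \<in> {1,2}" for js k
    using that cov_tens[OF mu u v that] by (simp add: nabla_def)
  have X: "(\<Sum>k\<in>{1,2}. cnj (dir k) * ?X k) = del u z - 2 * of_nat m * mu_z mu z * u z"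
    by (simp add: del_def algebra_simps)
  have Y: "(\<Sum>k\<in>{1,2}. dir k * ?Y k) = dbar v z - 2 * of_nat m * cnj (mu_z mu z) * v z"
    by (simp add: dbar_def algebra_simps)
  have "(\<Sum>js\<in>idx (m + 1). nabla mu m ?F js z * cnj (dz js)) =
      (\<Sum>js\<in>idx m. \<Sum>k\<in>{1,2}. cnj (dir k) * (tens m (?X k) (?Y k) js * cnj (dz js)))"
    unfolding Suc_eq_plus1[symmetric] sum_idx_snoc by (intro sum.cong refl) (simp add: nab del: One_nat_def)
  also have "\<dots> = (\<Sum>k\<in>{1,2}. cnj (dir k) * (2 ^ m * ?X k))"
    by (subst sum.swap) (simp only: sum_distrib_left[symmetric] sum_tens_cnj_dz[OF m])
  also have "\<dots> = 2 ^ m * (\<Sum>k\<in>{1,2}. cnj (dir k) * ?X k)"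
    by (simp only: sum_distrib_left mult.left_commute)
  finally have A: "(\<Sum>js\<in>idx (m + 1). nabla mu m ?F js z * cnj (dz js)) / 2 ^ (m + 1) =
      1/2 * (del u z - 2 * of_nat m * mu_z mu z * u z)"
    unfolding X by simp
  have "(\<Sum>js\<in>idx (m + 1). nabla mu m ?F js z * dz js) =
      (\<Sum>js\<in>idx m. \<Sum>k\<in>{1,2}. dir k * (tens m (?X k) (?Y k) js * dz js))"
    unfolding Suc_eq_plus1[symmetric] sum_idx_snoc by (intro sum.cong refl) (simp add: nab del: One_nat_def)
  also have "\<dots> = (\<Sum>k\<in>{1,2}. dir k * (2 ^ m * ?Y k))"
    by (subst sum.swap) (simp only: sum_distrib_left[symmetric] sum_tens_dz[OF m])
  also have "\<dots> = 2 ^ m * (\<Sum>k\<in>{1,2}. dir k * ?Y k)"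
    by (simp only: sum_distrib_left mult.left_commute)
  finally have B: "(\<Sum>js\<in>idx (m + 1). nabla mu m ?F js z * dz js) / 2 ^ (m + 1) =
      1/2 * (dbar v z - 2 * of_nat m * cnj (mu_z mu z) * v z)"
    unfolding Y by simp
  have "proj_field mu (m + 1) (dsym mu m ?F) is z =
      proj_pt mu (m + 1) z (symz (m + 1) (\<lambda>js. nabla mu m ?F js z)) is"
    by (simp add: proj_field_def dsym_def)
  also have "\<dots> = tens (m + 1) (1/2 * (del u z - 2 * of_nat m * mu_z mu z * u z))
      (1/2 * (dbar v z - 2 * of_nat m * cnj (mu_z mu z) * v z)) is"
    using m by (subst proj_symz) (simp_all only: A B le_add2)
  finally show "proj_field mu (m + 1) (dsym mu m ?F) is z = \<dots>" .
qed

text \<open>Contraction multiplies the connection term of u by the sum of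
  \<open>dir p * dir p\<close>, which is 0; so the outer derivative carries no weight
  inside.\<close>

lemma tdiv_tens:
  assumes mu: "\<And>z. mu differentiable (at z)"
    and u: "\<And>z. u differentiable (at z)" and v: "\<And>z. v differentiable (at z)"
  shows "tdiv mu m (\<lambda>is z. tens (m + 1) (u z) (v z) is) =
    (\<lambda>is z. tens m (of_real (exp (- 2 * mu z)) * dbar u z) (of_real (exp (- 2 * mu z)) * del v z) is)"
proof (intro ext)
  fix "is" z
  let ?F = "\<lambda>is z. tens (m + 1) (u z) (v z) is"
  let ?e = "complex_of_real (exp (- 2 * mu z))"
  show "tdiv mu m ?F is z = tens m (?e * dbar u z) (?e * del v z) is"
  proof (cases "is \<in> idx m")
    case True
    have "tdiv mu m ?F is z = ?e * (\<Sum>p\<in>{1,2}. cov mu ?F (p # is) p z)"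
      using True by (simp add: tdiv_def ginv_def algebra_simps)
    also have "(\<Sum>p\<in>{1,2}. cov mu ?F (p # is) p z) =
        (\<Sum>p\<in>{1,2}. tens (m + 1) (pder p u z - of_nat (m + 1) * mu_z mu z * dir p * u z)
          (pder p v z - of_nat (m + 1) * cnj (mu_z mu z) * cnj (dir p) * v z) (p # is))"
      using True by (intro sum.cong refl cov_tens mu u v) auto
    also have "\<dots> = dz is * dbar u z + cnj (dz is) * del v z"
      using True by (simp add: tens_def dbar_def del_def algebra_simps)
    finally show ?thesis using True by (simp add: tens_def algebra_simps)
  qed (simp add: tdiv_def tens_def)
qed

section \<open>The operator on the torus\<close>

locale conformal_torus = torus +
  fixes mu :: "complex \<Rightarrow> real" and m :: nat
  assumes mu_smooth: "tsmooth mu" and mu_per: "lattice_periodic w1 w2 mu" and m: "m \<ge> 1"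
begin

definition ew :: "real \<Rightarrow> complex \<Rightarrow> complex" where
  "ew a z = of_real (exp (a * mu z))"

lemma ew_mult: "ew a z * ew b z = ew (a + b) z"
  unfolding ew_def distrib_right exp_add by simp

lemma ew_0 [simp]: "ew 0 z = 1" by (simp add: ew_def)

lemma ew_cancel [simp]: "ew a z * (ew (- a) z * c) = c" "ew (- a) z * (ew a z * c) = c"
  by (simp_all add: mult.assoc[symmetric] ew_mult)

lemma ew_nonzero [simp]: "ew a z \<noteq> 0" by (simp add: ew_def)

lemma cnj_ew [simp]: "cnj (ew a z) = ew a z" by (simp add: ew_def)

lemma mu_differentiable: "mu differentiable (at z)"
  by (rule tsmooth_differentiable[OF mu_smooth])

lemma ew_exp: "ew a = (\<lambda>z. exp (of_real a * of_real (mu z)))"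
  by (simp add: fun_eq_iff ew_def exp_of_real[symmetric])

lemma tsmooth_ew: "tsmooth (ew a)"
  unfolding ew_exp by (intro tsmooth_exp tsmooth_cmult tsmooth_of_real mu_smooth)

lemma pder_ew: "pder k (ew a) z = ew a z * (of_real a * of_real (pder k mu z))"
proof -
  have 1: "(\<lambda>z. complex_of_real (mu z)) differentiable (at z)"
    by (rule tsmooth_differentiable[OF tsmooth_of_real[OF mu_smooth]])
  then have 2: "(\<lambda>z. of_real a * complex_of_real (mu z)) differentiable (at z)"
    by (intro differentiable_mult differentiable_const)
  show ?thesis
    using pder_exp[OF 2] pder_cmult[OF 1] pder_bounded_linear[OF bounded_linear_of_real[where 'a = complex] mu_differentiable]
    by (simp add: ew_exp)
qed

definition smp :: "(complex \<Rightarrow> complex) \<Rightarrow> bool" where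
  "smp f \<longleftrightarrow> tsmooth f \<and> lattice_periodic w1 w2 f"

lemma smp_ew: "smp (ew a)"
  using mu_per tsmooth_ew by (simp add: smp_def lattice_periodic_def ew_def)

lemma smp_add: "smp f \<Longrightarrow> smp g \<Longrightarrow> smp (\<lambda>z. f z + g z)"
  and smp_diff: "smp f \<Longrightarrow> smp g \<Longrightarrow> smp (\<lambda>z. f z - g z)"
  and smp_mult: "smp f \<Longrightarrow> smp g \<Longrightarrow> smp (\<lambda>z. f z * g z)"
  and smp_const: "smp (\<lambda>z. c)"
  and smp_cnj: "smp f \<Longrightarrow> smp (\<lambda>z. cnj (f z))"
  by (auto simp: smp_def lattice_periodic_def)

lemma smp_dbar: "smp f \<Longrightarrow> smp (dbar f)" and smp_del: "smp f \<Longrightarrow> smp (del f)"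
  by (auto simp: smp_def)

lemmas smp_intros = smp_add smp_diff smp_mult smp_const smp_cnj smp_dbar smp_del smp_ew

lemma smp_tcont: "smp f \<Longrightarrow> tcont f"
  by (simp add: smp_def tcont_smooth)

section \<open>The scalar operators on the two coefficients\<close>

definition P :: "(complex \<Rightarrow> complex) \<Rightarrow> complex \<Rightarrow> complex" where
  "P u z = ew (- 2) z * dbar (\<lambda>z. 1/2 * (ew (2 * m) z * del (\<lambda>z. ew (- (2 * m)) z * u z) z)) z"

definition Q :: "(complex \<Rightarrow> complex) \<Rightarrow> complex \<Rightarrow> complex" where
  "Q v z = ew (- 2) z * del (\<lambda>z. 1/2 * (ew (2 * m) z * dbar (\<lambda>z. ew (- (2 * m)) z * v z) z)) z"

lemma smp_P: "smp u \<Longrightarrow> smp (P u)"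
  unfolding P_def[abs_def] by (intro smp_intros)

text \<open>Conjugation exchanges \<open>del\<close> and \<open>dbar\<close> and fixes the real
  weights; every fact about \<open>Q\<close> is obtained from \<open>P\<close> in this way.\<close>

lemma Q_cnj:
  assumes u: "smp u" shows "Q (\<lambda>z. cnj (u z)) = (\<lambda>z. cnj (P u z))"
proof -
  have 1: "dbar (\<lambda>z. ew (- (2 * m)) z * cnj (u z)) = (\<lambda>z. cnj (del (\<lambda>z. ew (- (2 * m)) z * u z) z))"
  proof -
    have "smp (\<lambda>z. ew (- (2 * m)) z * u z)" by (intro smp_intros u)
    from dbar_cnj[OF this[unfolded smp_def, THEN conjunct1]] show ?thesis by simp
  qed
  have "smp (\<lambda>z. 1/2 * (ew (2 * m) z * del (\<lambda>z. ew (- (2 * m)) z * u z) z))"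
    by (intro smp_intros u)
  from del_cnj[OF this[unfolded smp_def, THEN conjunct1]]
  show ?thesis
    unfolding Q_def[abs_def] P_def[abs_def] 1 by (simp add: fun_eq_iff)
qed

lemma Q_eq: "smp v \<Longrightarrow> Q v = (\<lambda>z. cnj (P (\<lambda>z. cnj (v z)) z))"
  using Q_cnj[OF smp_cnj, of v] by simp

lemma smp_Q: "smp v \<Longrightarrow> smp (Q v)"
  by (subst Q_eq) (auto intro: smp_cnj smp_P)

text \<open>\<open>ew (- (2 * m))\<close> is an integrating factor: its derivative supplies exactly
  the connection term.\<close>

lemma del_twist:
  assumes "smp u"
  shows "1/2 * (del u z - 2 * of_nat m * mu_z mu z * u z) =
    1/2 * (ew (2 * m) z * del (\<lambda>z. ew (- (2 * m)) z * u z) z)"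
proof -
  have "del (\<lambda>z. ew (- (2 * m)) z * u z) z = ew (- (2 * m)) z * (del u z - 2 * of_nat m * mu_z mu z * u z)"
    using assms by (simp add: del_def mu_z_def smp_def pder_mult tsmooth_differentiable tsmooth_ew pder_ew algebra_simps)
  then show ?thesis by simp
qed

lemma dbar_twist:
  assumes "smp v"
  shows "1/2 * (dbar v z - 2 * of_nat m * cnj (mu_z mu z) * v z) =
    1/2 * (ew (2 * m) z * dbar (\<lambda>z. ew (- (2 * m)) z * v z) z)"
proof -
  have "dbar (\<lambda>z. ew (- (2 * m)) z * v z) z = ew (- (2 * m)) z * (dbar v z - 2 * of_nat m * cnj (mu_z mu z) * v z)"
    using assms by (simp add: dbar_def mu_z_def smp_def pder_mult tsmooth_differentiable tsmooth_ew pder_ew algebra_simps)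
  then show ?thesis by simp
qed

lemma dpd_tens:
  assumes u: "smp u" and v: "smp v"
  shows "dpd mu m (\<lambda>is z. tens m (u z) (v z) is) = (\<lambda>is z. tens m (P u z) (Q v z) is)"
proof -
  have diff: "smp f \<Longrightarrow> f differentiable (at z)" for f z
    by (simp add: smp_def tsmooth_differentiable)
  let ?U = "\<lambda>z. 1/2 * (ew (2 * m) z * del (\<lambda>z. ew (- (2 * m)) z * u z) z)"
  let ?V = "\<lambda>z. 1/2 * (ew (2 * m) z * dbar (\<lambda>z. ew (- (2 * m)) z * v z) z)"
  have UV: "smp ?U" "smp ?V" by (intro smp_intros u v)+
  have "dpd mu m (\<lambda>is z. tens m (u z) (v z) is) = tdiv mu m (\<lambda>is z. tens (m + 1) (?U z) (?V z) is)"
    unfolding dpd_def proj_dsym[OF m mu_differentiable diff[OF u] diff[OF v]]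
      del_twist[OF u] dbar_twist[OF v] ..
  also have "\<dots> = (\<lambda>is z. tens m (P u z) (Q v z) is)"
    unfolding tdiv_tens[OF mu_differentiable diff[OF UV(1)] diff[OF UV(2)]] P_def Q_def ew_def[of "- 2"] ..
  finally show ?thesis .
qed

lemma tint_dbar_smp: "smp f \<Longrightarrow> tint (dbar f) = 0" and tint_del_smp: "smp f \<Longrightarrow> tint (del f) = 0"
  by (auto simp: smp_def tint_dbar tint_del)

lemma tint_ew: "tint (ew a) \<noteq> 0"
proof
  assume "tint (ew a) = 0"
  then have "exp (a * mu 0) = 0"
    using smp_tcont[OF smp_ew, of a] by (intro tint_nonneg_eq_0) (auto simp: ew_def[abs_def])
  then show False by simp
qed

text \<open>The outer \<open>dbar\<close> leaves a constant c, so \<open>del\<close> of the weighted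
  u equals \<open>2 * c * ew (- (2 * m))\<close>. The left side has mean 0 and the weight is
  positive, which forces c = 0; then the weighted u is constant.\<close>

lemma P_eq_0_iff:
  assumes u: "smp u"
  shows "P u = (\<lambda>z. 0) \<longleftrightarrow> (\<exists>c. u = (\<lambda>z. ew (2 * m) z * c))"
proof
  let ?w = "\<lambda>z. ew (- (2 * m)) z * u z"
  let ?f = "\<lambda>z. 1/2 * (ew (2 * m) z * del ?w z)"
  have w: "smp ?w" by (intro smp_intros u)
  have f: "smp ?f" by (intro smp_intros u)
  assume "P u = (\<lambda>z. 0)"
  then have "dbar ?f = (\<lambda>z. 0)"
    by (simp add: fun_eq_iff P_def)
  with f obtain c where c: "?f = (\<lambda>z. c)"
    by (auto simp: smp_def elim: dbar_kernel)
  have "del ?w = (\<lambda>z. 2 * c * ew (- (2 * m)) z)"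
  proof
    fix z
    have "2 * c * ew (- (2 * m)) z = 2 * ?f z * ew (- (2 * m)) z"
      using fun_cong[OF c, of z] by simp
    then show "del ?w z = 2 * c * ew (- (2 * m)) z"
      by (simp add: mult_ac)
  qed
  then have "tint (\<lambda>z. 2 * c * ew (- (2 * m)) z) = 0"
    using tint_del_smp[OF w] by simp
  then have "c = 0" using tint_ew by simp
  with \<open>del ?w = _\<close> have "del ?w = (\<lambda>z. 0)" by simp
  with w obtain d where d: "?w = (\<lambda>z. d)"
    by (auto simp: smp_def elim: del_kernel)
  have "u z = ew (2 * m) z * d" for z
    using fun_cong[OF d, of z] ew_cancel(1)[of "2 * m" z "u z"] by simp
  then show "\<exists>c. u = (\<lambda>z. ew (2 * m) z * c)" by blast
next
  assume "\<exists>c. u = (\<lambda>z. ew (2 * m) z * c)"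
  then show "P u = (\<lambda>z. 0)"
    by (auto simp: fun_eq_iff P_def del_def dbar_def)
qed

lemma Q_eq_0_iff:
  assumes v: "smp v"
  shows "Q v = (\<lambda>z. 0) \<longleftrightarrow> (\<exists>c. v = (\<lambda>z. ew (2 * m) z * c))"
proof -
  have "Q v = (\<lambda>z. 0) \<longleftrightarrow> P (\<lambda>z. cnj (v z)) = (\<lambda>z. 0)"
    by (simp add: Q_eq[OF v] fun_eq_iff)
  also have "\<dots> \<longleftrightarrow> (\<exists>c. (\<lambda>z. cnj (v z)) = (\<lambda>z. ew (2 * m) z * c))"
    by (rule P_eq_0_iff[OF smp_cnj[OF v]])
  also have "\<dots> \<longleftrightarrow> (\<exists>c. v = (\<lambda>z. ew (2 * m) z * c))"
    unfolding fun_eq_iff by (metis cnj_ew complex_cnj_cnj complex_cnj_mult)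
  finally show ?thesis .
qed

text \<open>The area density cancels the leading factor \<open>ew (- 2)\<close>, leaving the
  integral of a pure \<open>dbar\<close>.\<close>

lemma tint_P:
  assumes "smp u" shows "tint (\<lambda>z. ew 2 z * P u z) = 0"
proof -
  have "smp (\<lambda>z. 1/2 * (ew (2 * m) z * del (\<lambda>z. ew (- (2 * m)) z * u z) z))"
    by (intro smp_intros assms)
  from tint_dbar_smp[OF this] show ?thesis by (simp add: P_def)
qed

lemma tint_Q:
  assumes "smp v" shows "tint (\<lambda>z. ew 2 z * Q v z) = 0"
  using tint_cnj[of "\<lambda>z. ew 2 z * P (\<lambda>z. cnj (v z)) z"] tint_P[OF smp_cnj[OF assms]]
  by (simp add: Q_eq[OF assms])

lemma P_surj:
  assumes g: "smp g" and mean: "tint (\<lambda>z. ew 2 z * g z) = 0"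
  obtains u where "smp u" "P u = g"
proof -
  have h: "tsmooth (\<lambda>z. ew 2 z * g z)" "lattice_periodic w1 w2 (\<lambda>z. ew 2 z * g z)"
    using smp_mult[OF smp_ew g] by (auto simp: smp_def)
  from dbar_solvable[OF h mean] obtain f where f: "smp f" "dbar f = (\<lambda>z. ew 2 z * g z)"
    unfolding smp_def by blast
  let ?e = "ew (- (2 * m))"
  \<comment> \<open>dbar determines f only up to a constant, which is used up to make the second equation solvable\<close>
  define c where "c = tint (\<lambda>z. ?e z * f z) / tint ?e"
  \<comment> \<open>The factor 2 and the weight undo \<open>1/2 * ew (2 * m)\<close>, so that the
    argument of the outer \<open>dbar\<close> becomes \<open>f - c\<close>.\<close>
  let ?h = "\<lambda>z. 2 * (?e z * f z - c * ?e z)"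
  have "tint (\<lambda>z. ?e z * f z - c * ?e z) = tint (\<lambda>z. ?e z * f z) - tint (\<lambda>z. c * ?e z)"
    by (intro tint_diff smp_tcont smp_intros f)
  also have "\<dots> = 0" using tint_ew by (simp add: c_def)
  finally have mean': "tint ?h = 0" by (subst set_integral_mult_right) simp
  have "smp ?h" by (intro smp_intros f)
  then have "tsmooth ?h" "lattice_periodic w1 w2 ?h" by (simp_all only: smp_def)
  from del_solvable[OF this mean'] obtain w where w: "smp w" "del w = ?h"
    unfolding smp_def by blast
  show ?thesis
  proof
    show "smp (\<lambda>z. ew (2 * m) z * w z)" by (intro smp_intros w)
    have 1: "(\<lambda>z. 1/2 * (ew (2 * m) z * del (\<lambda>z. ?e z * (ew (2 * m) z * w z)) z)) = (\<lambda>z. f z - c)"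
    proof
      fix z
      have "1/2 * (ew (2 * m) z * del w z) = ew (2 * m) z * (?e z * f z) - ew (2 * m) z * (?e z * c)"
        unfolding w(2) by (simp add: right_diff_distrib mult_ac)
      then show "1/2 * (ew (2 * m) z * del (\<lambda>z. ?e z * (ew (2 * m) z * w z)) z) = f z - c"
        by simp
    qed
    have 2: "dbar (\<lambda>z. f z - c) = dbar f"
    proof -
      have "(\<lambda>z. f z + (- c)) = (\<lambda>z. f z - c)" by simp
      moreover have "pder k (\<lambda>z. f z + (- c)) z = pder k f z" for k z
        using f(1) by (subst pder_add) (auto simp: smp_def tsmooth_differentiable)
      ultimately show ?thesis by (simp add: fun_eq_iff dbar_def)
    qed
    show "P (\<lambda>z. ew (2 * m) z * w z) = g"
      unfolding P_def[abs_def] 1 2 f(2) by simp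
  qed
qed

lemma Q_surj:
  assumes g: "smp g" and mean: "tint (\<lambda>z. ew 2 z * g z) = 0"
  obtains v where "smp v" "Q v = g"
proof -
  have "tint (\<lambda>z. ew 2 z * cnj (g z)) = 0"
    using tint_cnj[of "\<lambda>z. ew 2 z * g z"] mean by simp
  from P_surj[OF smp_cnj[OF g] this] obtain u where u: "smp u" "P u = (\<lambda>z. cnj (g z))" .
  show ?thesis
    by (rule that[OF smp_cnj[OF u(1)]]) (simp add: Q_cnj[OF u(1)] u(2))
qed

section \<open>Kernel and range for trace free fields\<close>

lemma kerj_fields_iff:
  "F \<in> kerj_fields mu w1 w2 m \<longleftrightarrow> (\<exists>u v. smp u \<and> smp v \<and> F = (\<lambda>is z. tens m (u z) (v z) is))"
proof
  assume F: "F \<in> kerj_fields mu w1 w2 m"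
  then have smp: "smp (F is)" for "is"
    by (auto simp: kerj_fields_def smp_def)
  let ?a = "F (replicate m 1)" and ?b = "F (replicate (m - 1) 1 @ [2])"
  have "F is z = tens m (1/2 * (?a z - \<i> * ?b z)) (1/2 * (?a z + \<i> * ?b z)) is" for "is" z
  proof -
    have "(\<lambda>is. F is z) \<in> kerj_pt mu m z" using F by (simp add: kerj_fields_def)
    from fun_cong[OF kerj_tens[OF this], of "is"] show ?thesis by simp
  qed
  moreover have "smp (\<lambda>z. 1/2 * (?a z - \<i> * ?b z))" "smp (\<lambda>z. 1/2 * (?a z + \<i> * ?b z))"
    by (intro smp_intros smp)+
  ultimately show "\<exists>u v. smp u \<and> smp v \<and> F = (\<lambda>is z. tens m (u z) (v z) is)" by blast
next
  assume "\<exists>u v. smp u \<and> smp v \<and> F = (\<lambda>is z. tens m (u z) (v z) is)"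
  then obtain u v where F: "smp u" "smp v" "F = (\<lambda>is z. tens m (u z) (v z) is)" by blast
  have "smp (F is)" for "is"
  proof (cases "is \<in> idx m")
    case True
    then have "F is = (\<lambda>z. dz is * u z + cnj (dz is) * v z)"
      by (simp add: F(3) tens_def)
    then show ?thesis using F(1,2) by (simp only:) (intro smp_intros)
  next
    case False
    then have "F is = (\<lambda>z. 0)" by (simp add: F(3) tens_def)
    then show ?thesis by (simp add: smp_const)
  qed
  moreover have "(\<lambda>is. F is z) \<in> kerj_pt mu m z" for z
    using tens_kerj[of m "u z" "v z" mu z] by (simp add: F(3))
  ultimately show "F \<in> kerj_fields mu w1 w2 m"
    by (simp add: kerj_fields_def smp_def)
qed

lemma tens_eq_0_iff: "(\<lambda>is z. tens m (u z) (v z) is) = (\<lambda>is z. 0) \<longleftrightarrow> u = (\<lambda>z. 0) \<and> v = (\<lambda>z. 0)"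
proof
  assume eq: "(\<lambda>is z. tens m (u z) (v z) is) = (\<lambda>is z. 0)"
  have "u z = 0 \<and> v z = 0" for z
    using fun_cong[OF fun_cong[OF eq]] by (intro tens_inject[OF m]) (simp add: tens_def[of _ 0 0])
  then show "u = (\<lambda>z. 0) \<and> v = (\<lambda>z. 0)" by auto
qed (simp add: tens_def fun_eq_iff)

lemma kernel_dpd:
  assumes F: "F \<in> kerj_fields mu w1 w2 m"
  shows "dpd mu m F = (\<lambda>is z. 0) \<longleftrightarrow> (\<exists>a b. F (replicate m 1) = (\<lambda>z. ew (2 * m) z * a) \<and>
    F (replicate (m - 1) 1 @ [2]) = (\<lambda>z. ew (2 * m) z * b))"
proof -
  obtain u v where u: "smp u" and v: "smp v" and Feq: "F = (\<lambda>is z. tens m (u z) (v z) is)"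
    using F unfolding kerj_fields_iff by blast
  have "dpd mu m F = (\<lambda>is z. 0) \<longleftrightarrow>
      (\<exists>c. u = (\<lambda>z. ew (2 * m) z * c)) \<and> (\<exists>d. v = (\<lambda>z. ew (2 * m) z * d))"
    unfolding Feq dpd_tens[OF u v] tens_eq_0_iff P_eq_0_iff[OF u] Q_eq_0_iff[OF v] ..
  also have "\<dots> \<longleftrightarrow> (\<exists>a b. (\<lambda>z. u z + v z) = (\<lambda>z. ew (2 * m) z * a) \<and>
      (\<lambda>z. \<i> * (u z - v z)) = (\<lambda>z. ew (2 * m) z * b))"
  proof (intro iffI; elim exE conjE)
    fix c d assume "u = (\<lambda>z. ew (2 * m) z * c)" "v = (\<lambda>z. ew (2 * m) z * d)"
    then show "\<exists>a b. (\<lambda>z. u z + v z) = (\<lambda>z. ew (2 * m) z * a) \<and>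
        (\<lambda>z. \<i> * (u z - v z)) = (\<lambda>z. ew (2 * m) z * b)"
      by (intro exI[of _ "c + d"] exI[of _ "\<i> * (c - d)"]) (simp add: algebra_simps)
  next
    fix a b assume ab: "(\<lambda>z. u z + v z) = (\<lambda>z. ew (2 * m) z * a)"
      "(\<lambda>z. \<i> * (u z - v z)) = (\<lambda>z. ew (2 * m) z * b)"
    \<comment> \<open>Inverts the passage from (u, v) to the components u + v and i (u - v).\<close>
    have "u z = 1/2 * ((u z + v z) - \<i> * (\<i> * (u z - v z)))"
      "v z = 1/2 * ((u z + v z) + \<i> * (\<i> * (u z - v z)))" for z
      by (simp_all add: mult.assoc[symmetric])
    then have "u z = 1/2 * (ew (2 * m) z * a - \<i> * (ew (2 * m) z * b))"
      "v z = 1/2 * (ew (2 * m) z * a + \<i> * (ew (2 * m) z * b))" for z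
      using fun_cong[OF ab(1), of z] fun_cong[OF ab(2), of z] by metis+
    then have "u = (\<lambda>z. ew (2 * m) z * (1/2 * (a - \<i> * b)))" "v = (\<lambda>z. ew (2 * m) z * (1/2 * (a + \<i> * b)))"
      by (simp_all add: fun_eq_iff algebra_simps)
    then show "(\<exists>c. u = (\<lambda>z. ew (2 * m) z * c)) \<and> (\<exists>d. v = (\<lambda>z. ew (2 * m) z * d))"
      by blast
  qed
  finally show ?thesis
    by (simp only: Feq tens_11[OF m] tens_12[OF m])
qed

text \<open>The components of \<open>dz\<close> are constants, so the integrals of the components
  are themselves the components of a constant tensor.\<close>

lemma integral_tens:
  assumes "smp u" "smp v" "is \<in> idx m"
  shows "integral D (\<lambda>z. tens m (u z) (v z) is * of_real (exp (2 * mu z))) =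
    dz is * tint (\<lambda>z. ew 2 z * u z) + cnj (dz is) * tint (\<lambda>z. ew 2 z * v z)"
proof -
  have "(\<lambda>z. tens m (u z) (v z) is * of_real (exp (2 * mu z))) =
      (\<lambda>z. dz is * (ew 2 z * u z) + cnj (dz is) * (ew 2 z * v z))"
    using assms(3) by (simp add: fun_eq_iff tens_def ew_def algebra_simps)
  moreover have 1: "tcont (\<lambda>z. dz is * (ew 2 z * u z))" "tcont (\<lambda>z. cnj (dz is) * (ew 2 z * v z))"
    by (intro smp_tcont smp_intros assms)+
  ultimately show ?thesis
    using integral_eq_tint[OF tcontD(1)[OF tcont_add[OF 1]]] tint_add[OF 1] by simp
qed

lemma range_dpd:
  "dpd mu m ` kerj_fields mu w1 w2 m =
    {G \<in> kerj_fields mu w1 w2 m. \<forall>is\<in>idx m. integral D (\<lambda>z. G is z * of_real (exp (2 * mu z))) = 0}"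
proof (intro equalityI subsetI)
  fix G assume "G \<in> dpd mu m ` kerj_fields mu w1 w2 m"
  then obtain u v where u: "smp u" and v: "smp v" and G: "G = dpd mu m (\<lambda>is z. tens m (u z) (v z) is)"
    unfolding image_iff Bex_def kerj_fields_iff by blast
  note smp = smp_P[OF u] smp_Q[OF v]
  show "G \<in> {G \<in> kerj_fields mu w1 w2 m. \<forall>is\<in>idx m. integral D (\<lambda>z. G is z * of_real (exp (2 * mu z))) = 0}"
    unfolding G dpd_tens[OF u v]
    using smp by (auto simp: kerj_fields_iff integral_tens tint_P[OF u] tint_Q[OF v])
next
  fix G assume "G \<in> {G \<in> kerj_fields mu w1 w2 m.
    \<forall>is\<in>idx m. integral D (\<lambda>z. G is z * of_real (exp (2 * mu z))) = 0}"
  then obtain f g where f: "smp f" and g: "smp g" and G: "G = (\<lambda>is z. tens m (f z) (g z) is)"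
    and int: "\<And>is. is \<in> idx m \<Longrightarrow> integral D (\<lambda>z. G is z * of_real (exp (2 * mu z))) = 0"
    unfolding mem_Collect_eq kerj_fields_iff by blast
  let ?a = "tint (\<lambda>z. ew 2 z * f z)" and ?b = "tint (\<lambda>z. ew 2 z * g z)"
  \<comment> \<open>Vanishing of all component integrals thus says that a constant tensor is 0, and
    injectivity yields the two scalar mean conditions.\<close>
  have "tens m ?a ?b is = tens m 0 0 is" for "is"
    using int[of "is"] integral_tens[OF f g, of "is"] by (simp add: G tens_def)
  then have "?a = 0 \<and> ?b = 0" by (rule tens_inject[OF m])
  then have a0: "?a = 0" and b0: "?b = 0" by auto
  obtain u where "smp u" "P u = f" by (rule P_surj[OF f a0])
  moreover obtain v where "smp v" "Q v = g" by (rule Q_surj[OF g b0])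
  ultimately show "G \<in> dpd mu m ` kerj_fields mu w1 w2 m"
    unfolding G by (intro image_eqI[of _ _ "\<lambda>is z. tens m (u z) (v z) is"])
      (auto simp: dpd_tens kerj_fields_iff)
qed

end

theorem theorem3p1:
  fixes w1 w2 :: complex and mu :: "complex \<Rightarrow> real" and m :: nat
  assumes lattice: "Im (cnj w1 * w2) \<noteq> 0"
    and mu_smooth: "tsmooth mu" and mu_per: "lattice_periodic w1 w2 mu"
    and m: "m \<ge> 1"
  shows "{F \<in> kerj_fields mu w1 w2 m. dpd mu m F = (\<lambda>is z. 0)} =
           {F \<in> kerj_fields mu w1 w2 m. \<exists>c1 c2 :: complex.
               F (replicate m 1) = (\<lambda>z. of_real (exp (2 * real m * mu z)) * c1) \<and>
               F (replicate (m - 1) 1 @ [2]) = (\<lambda>z. of_real (exp (2 * real m * mu z)) * c2)} \<and>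
         dpd mu m ` kerj_fields mu w1 w2 m =
           {G \<in> kerj_fields mu w1 w2 m. \<forall>is\<in>idx m.
               integral (fund_dom w1 w2) (\<lambda>z. G is z * of_real (exp (2 * mu z))) = 0}"
proof -
  interpret conformal_torus w1 w2 mu m
    using assms by unfold_locales
  show ?thesis
    using kernel_dpd range_dpd by (auto simp: ew_def)
qed

end
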